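(* Let $F(\theta)=\mathbb{E}_\xi f(\theta,\xi)$ be $L$-smooth and $l$-lower smooth on $\Omega$, let $\theta_0\in\Omega$, let $\theta^*$ be a minimizer of $F$ over $\Omega$, and let $N\ge1$ be an integer. Run the stochastic NCGS algorithm (defined in the context) with, for $k=1,\dots,N$, $\alpha_k=\frac{2}{k+1}$, $\beta_k=\frac{1}{2L}$, $\lambda_k=\frac{k\beta_k}{2}$, $\eta_k=\chi_k=\frac1N$, $m_k=k$, and $p_k=\frac{\Gamma_k^{-1}}{\sum_{j=1}^N\Gamma_j^{-1}}$ where $\Gamma_k=\frac{2}{k(k+1)}$. Then $$\mathbb{E}\big[\|g(\theta_R^{md},\bar G_R,\beta_R)\|^2\big]\le 192L\left(\frac{4L\|\theta_0-\theta^*\|^2}{N^2(N+1)}+\frac{l}{N}\big(\|\theta^*\|^2+2M^2\big)+\frac1N+\frac{3\sigma^2}{2LN}\right).$$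
   Context: Setting: $\Omega\subset\mathbb{R}^p$ is nonempty, compact and convex; $F:\mathbb{R}^p\to\mathbb{R}$ is differentiable and possibly non-convex; norms are Euclidean. $F$ is $L$-smooth ($L>0$) on $\Omega$ if $\|\nabla F(\theta_1)-\nabla F(\theta_2)\|\le L\|\theta_1-\theta_2\|$ for all $\theta_1,\theta_2\in\Omega$. $F$ is $l$-lower smooth ($l\ge 0$) if $-\frac{l}{2}\|\theta_1-\theta_2\|^2\le F(\theta_1)-F(\theta_2)-\langle\nabla F(\theta_2),\theta_1-\theta_2\rangle$ for all $\theta_1,\theta_2\in\Omega$. Stochastic gradients: $G(\theta,\xi)=\nabla_\theta f(\theta,\xi)$ with $\xi\sim P$ satisfies, for every $\theta\in\mathbb{R}^p$, $\mathbb{E}\,G(\theta,\xi)=\nabla F(\theta)$ and $\mathbb{E}\|G(\theta,\xi)-\nabla F(\theta)\|^2\le\sigma^2$. For $x,\omega\in\mathbb{R}^p$ and $\gamma>0$: $\psi(x,\omega,\gamma)=\arg\min_{\theta\in\Omega}\langle\omega,\theta\rangle+\frac{1}{2\gamma}\|\theta-x\|^2$, and the gradient mapping is $g(x,\omega,\gamma)=\frac1\gamma\big(x-\psi(x,\omega,\gamma)\big)$. The constant $M$ satisfies $\|\psi(x,\omega,\gamma)\|\le M$ for all $x\in\Omega$, $\omega\in\mathbb{R}^p$, $\gamma\in(0,\infty)$. Procedure $u^+=condg(w,u,\lambda,\eta)$, for $w\in\mathbb{R}^p$, $u\in\Omega$, $\lambda,\eta>0$: set $u_1=u$. For $t=1,2,\dots$: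 let $v_t\in\Omega$ attain $V(u_t)=\max_{x\in\Omega}\langle w+\frac1\lambda(u_t-u),u_t-x\rangle$; if $V(u_t)\le\eta$, return $u^+=u_t$ and stop; otherwise set $u_{t+1}=(1-\xi_t)u_t+\xi_tv_t$ with $\xi_t=\min\Big\{1,\frac{\langle\frac1\lambda(u-u_t)-w,\,v_t-u_t\rangle}{\frac1\lambda\|v_t-u_t\|^2}\Big\}$. Stochastic NCGS algorithm with parameters $\alpha_k,\lambda_k,\beta_k,\eta_k,\chi_k$, batch sizes $m_k$ and probabilities $p_k$: draw $R\in\{1,\dots,N\}$ with $\mathrm{Prob}\{R=k\}=p_k$, independently of all samples $\xi_{k,i}$, which are i.i.d. from $P$. Set $\theta_0^{ag}=\theta_0$. For $k=1,\dots,R$: - $\theta_k^{md}=(1-\alpha_k)\theta_{k-1}^{ag}+\alpha_k\theta_{k-1}$; - $\bar G_k=\frac1{m_k}\sum_{i=1}^{m_k}G(\theta_k^{md},\xi_{k,i})$ with fresh samples $\xi_{k,1},\dots,\xi_{k,m_k}$; - $\theta_k=condg(\bar G_k,\theta_{k-1},\lambda_k,\eta_k)$; - $\theta_k^{ag}=condg(\bar G_k,\theta_k^{md},\beta_k,\chi_k)$. The expectation is over $R$ and all samples. *)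

theory Defs
  imports "HOL-Probability.Probability"
begin

section \<open>Gradients and smoothness\<close>

definition grad :: "('a::real_inner \<Rightarrow> real) \<Rightarrow> 'a \<Rightarrow> 'a" where
  "grad F x = (THE D. GDERIV F x :> D)"

text \<open>The description is meaningful at every point of differentiability:\<close>

lemma GDERIV_grad:
  fixes F :: "'a::euclidean_space \<Rightarrow> real"
  assumes "F differentiable (at x)"
  shows "GDERIV F x :> grad F x"
proof -
  obtain F' where F': "(F has_derivative F') (at x)"
    using assms by (auto simp: differentiable_def)
  interpret F': linear F' using F' by (rule has_derivative_linear)
  have "F' h = h \<bullet> (\<Sum>b\<in>Basis. F' b *\<^sub>R b)" for h
  proof -
    have "F' h = F' (\<Sum>b\<in>Basis. (h \<bullet> b) *\<^sub>R b)" by (simp only: euclidean_representation)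
    also have "\<dots> = (\<Sum>b\<in>Basis. (h \<bullet> b) * F' b)" by (simp add: F'.sum F'.scale)
    also have "\<dots> = h \<bullet> (\<Sum>b\<in>Basis. F' b *\<^sub>R b)"
      by (simp add: inner_sum_right mult.commute)
    finally show ?thesis .
  qed
  then have "F' = (\<lambda>h. h \<bullet> (\<Sum>b\<in>Basis. F' b *\<^sub>R b))" by (rule ext)
  then have ex: "GDERIV F x :> (\<Sum>b\<in>Basis. F' b *\<^sub>R b)"
    using F' unfolding gderiv_def
    by (rule subst[where P = "\<lambda>g. (F has_derivative g) (at x)"])
  have unique: "D = D'" if "GDERIV F x :> D" "GDERIV F x :> D'" for D D'
  proof -
    have "(\<lambda>h. h \<bullet> D) = (\<lambda>h. h \<bullet> D')"
      using that has_derivative_unique unfolding gderiv_def by blast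
    then have "\<And>h. h \<bullet> D = h \<bullet> D'" by (rule fun_cong)
    then show ?thesis using vector_eq_ldot[of D D'] by blast
  qed
  show ?thesis
    unfolding grad_def by (rule theI[where P = "\<lambda>D. GDERIV F x :> D", OF ex]) (rule unique[OF _ ex])
qed

definition smooth_on :: "real \<Rightarrow> ('a::real_inner \<Rightarrow> real) \<Rightarrow> 'a set \<Rightarrow> bool" where
  "smooth_on L F \<Omega> \<longleftrightarrow>
     (\<forall>x\<in>\<Omega>. \<forall>y\<in>\<Omega>. norm (grad F x - grad F y) \<le> L * norm (x - y))"

definition lower_smooth_on :: "real \<Rightarrow> ('a::real_inner \<Rightarrow> real) \<Rightarrow> 'a set \<Rightarrow> bool" where
  "lower_smooth_on l F \<Omega> \<longleftrightarrow>
     (\<forall>x\<in>\<Omega>. \<forall>y\<in>\<Omega>. - (l / 2) * (norm (x - y))\<^sup>2 \<le> F x - F y - grad F y \<bullet> (x - y))"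

definition stoch_grad :: "('a::real_inner \<Rightarrow> 's \<Rightarrow> real) \<Rightarrow> 'a \<Rightarrow> 's \<Rightarrow> 'a" where
  "stoch_grad f x s = grad (\<lambda>y. f y s) x"

section \<open>The gradient mapping\<close>

definition prox_pt :: "'a::real_inner set \<Rightarrow> 'a \<Rightarrow> 'a \<Rightarrow> real \<Rightarrow> 'a" where
  "prox_pt \<Omega> x w \<gamma> = arg_min_on (\<lambda>y. w \<bullet> y + 1 / (2 * \<gamma>) * (norm (y - x))\<^sup>2) \<Omega>"

definition grad_mapping :: "'a::real_inner set \<Rightarrow> 'a \<Rightarrow> 'a \<Rightarrow> real \<Rightarrow> 'a" where
  "grad_mapping \<Omega> x w \<gamma> = (1 / \<gamma>) *\<^sub>R (x - prox_pt \<Omega> x w \<gamma>)"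

section \<open>The conditional gradient procedure\<close>

definition condg_gap :: "'a::real_inner set \<Rightarrow> 'a \<Rightarrow> 'a \<Rightarrow> real \<Rightarrow> 'a \<Rightarrow> real" where
  "condg_gap \<Omega> w u lam y = (SUP x\<in>\<Omega>. (w + (1 / lam) *\<^sub>R (y - u)) \<bullet> (y - x))"

definition condg_step :: "'a::real_inner \<Rightarrow> 'a \<Rightarrow> real \<Rightarrow> 'a \<Rightarrow> 'a \<Rightarrow> real" where
  "condg_step w u lam y v =
     min 1 ((((1 / lam) *\<^sub>R (u - y) - w) \<bullet> (v - y)) / ((1 / lam) * (norm (v - y))\<^sup>2))"

text \<open>
  The maximiser \<open>v\<close> of the linear subproblem need not be unique, and the procedure may
  use any of them; so it is modelled as a relation rather than a function.
  \<open>condg_iterate \<Omega> w u lam \<eta> y\<close> says that \<open>y\<close> is an iterate of some run,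
  \<open>condg \<Omega> w u lam \<eta> y\<close> that it is the point returned by some run.
\<close>

inductive condg_iterate ::
  "'a::real_inner set \<Rightarrow> 'a \<Rightarrow> 'a \<Rightarrow> real \<Rightarrow> real \<Rightarrow> 'a \<Rightarrow> bool"
  for \<Omega> w u lam \<eta>
where
  start: "condg_iterate \<Omega> w u lam \<eta> u"
| step: "\<lbrakk>condg_iterate \<Omega> w u lam \<eta> y; \<not> condg_gap \<Omega> w u lam y \<le> \<eta>;
          v \<in> \<Omega>; (w + (1 / lam) *\<^sub>R (y - u)) \<bullet> (y - v) = condg_gap \<Omega> w u lam y;
          s = condg_step w u lam y v\<rbrakk>
         \<Longrightarrow> condg_iterate \<Omega> w u lam \<eta> ((1 - s) *\<^sub>R y + s *\<^sub>R v)"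

definition condg ::
  "'a::real_inner set \<Rightarrow> 'a \<Rightarrow> 'a \<Rightarrow> real \<Rightarrow> real \<Rightarrow> 'a \<Rightarrow> bool" where
  "condg \<Omega> w u lam \<eta> y \<longleftrightarrow> condg_iterate \<Omega> w u lam \<eta> y \<and> condg_gap \<Omega> w u lam y \<le> \<eta>"

text \<open>
  The procedure terminates whatever maximisers are used: each step that is not the last
  decreases \<open>\<phi> y = w \<bullet> y + (norm (y - u))\<^sup>2 / (2 * lam)\<close> by a fixed positive
  amount. Hence requiring a point to be returned by it is no restriction.
\<close>

lemma condg_step_decrease:
  fixes \<Omega> :: "'a::euclidean_space set" and u w :: 'a
  assumes \<Omega>: "compact \<Omega>" "convex \<Omega>" "u \<in> \<Omega>" and pos: "lam > 0" "\<eta> > 0"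
  defines "\<phi> \<equiv> \<lambda>y. w \<bullet> y + (norm (y - u))\<^sup>2 / (2 * lam)"
  shows "\<exists>c>0. \<forall>y\<in>\<Omega>. \<forall>v\<in>\<Omega>. (w + (1 / lam) *\<^sub>R (y - u)) \<bullet> (y - v) > \<eta> \<longrightarrow>
     (\<forall>z. z = (1 - condg_step w u lam y v) *\<^sub>R y + condg_step w u lam y v *\<^sub>R v \<longrightarrow>
       z \<in> \<Omega> \<and> \<phi> z \<le> \<phi> y - c)"
proof -
  obtain B where B: "B > 0" "\<And>x. x \<in> \<Omega> \<Longrightarrow> norm x \<le> B"
    using compact_imp_bounded[OF \<Omega>(1)] by (auto simp: bounded_pos)
  define c where "c = min (\<eta> / 2) (\<eta>\<^sup>2 * lam / (2 * (2 * B)\<^sup>2))"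
  show ?thesis
  proof (intro exI[of _ c] conjI ballI allI impI)
    show "c > 0" using pos B by (simp add: c_def)
  next
    fix y v z assume y: "y \<in> \<Omega>" and v: "v \<in> \<Omega>"
      and gap: "(w + (1 / lam) *\<^sub>R (y - u)) \<bullet> (y - v) > \<eta>"
      and z_eq: "z = (1 - condg_step w u lam y v) *\<^sub>R y + condg_step w u lam y v *\<^sub>R v"
    define h V n s where "h = v - y" and "V = (w + (1 / lam) *\<^sub>R (y - u)) \<bullet> (y - v)"
      and "n = (norm h)\<^sup>2" and "s = condg_step w u lam y v"
    have Vpos: "V > \<eta>" "V > 0" using gap pos by (auto simp: V_def)
    have "h \<noteq> 0" using Vpos by (auto simp: V_def h_def)
    then have n: "n > 0" by (simp add: n_def)
    have "norm h \<le> 2 * B"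
      using B(2)[OF y] B(2)[OF v] norm_triangle_ineq4[of v y] by (simp add: h_def)
    then have n_le: "n \<le> (2 * B)\<^sup>2" unfolding n_def by (rule power_mono) simp
    have "((1 / lam) *\<^sub>R (u - y) - w) \<bullet> (v - y) = V"
      by (simp add: V_def algebra_simps inner_simps)
    then have s: "s = min 1 (V * lam / n)"
      by (simp add: s_def condg_step_def n_def h_def)
    then have s01: "0 \<le> s" "s \<le> 1" using Vpos n pos by auto
    have z: "z = y + s *\<^sub>R h"
      unfolding z_eq s_def[symmetric] h_def by (simp add: algebra_simps)
    define d where "d = y - u"
    have V: "V = - (w \<bullet> h) - (d \<bullet> h) / lam"
      unfolding V_def d_def minus_diff_eq[of v y, symmetric] h_def[symmetric]
      by (simp add: inner_add_left)
    have "y + s *\<^sub>R h - u = d + s *\<^sub>R h" by (simp add: d_def)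
    moreover have "(norm (d + s *\<^sub>R h))\<^sup>2 = (norm d)\<^sup>2 + 2 * s * (d \<bullet> h) + s\<^sup>2 * n"
      unfolding n_def power2_norm_eq_inner
      by (simp add: inner_add_left inner_add_right inner_commute power2_eq_square)
    ultimately have "\<phi> (y + s *\<^sub>R h) =
        w \<bullet> y + s * (w \<bullet> h) + ((norm d)\<^sup>2 + 2 * s * (d \<bullet> h) + s\<^sup>2 * n) / (2 * lam)"
      by (simp only: \<phi>_def inner_add_right inner_scaleR_right)
    also have "\<dots> = \<phi> y - s * V + s\<^sup>2 * n / (2 * lam)"
      using pos by (simp add: \<phi>_def V d_def[symmetric] add_divide_distrib right_diff_distrib)
    finally have \<phi>: "\<phi> (y + s *\<^sub>R h) = \<phi> y - s * V + s\<^sup>2 * n / (2 * lam)" .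
    have c_le: "c \<le> s * V - s\<^sup>2 * n / (2 * lam)"
    proof (cases "V * lam / n \<ge> 1")
      case True
      then have "s = 1" "n \<le> V * lam" using s n by (auto simp: divide_simps)
      moreover from this have "n / (2 * lam) \<le> V / 2" using pos by (simp add: divide_simps)
      ultimately show ?thesis using Vpos by (simp add: c_def)
    next
      case False
      then have "s = V * lam / n" using s by simp
      then have "s\<^sup>2 * n = s * (V * lam)" "s * V / 2 = V\<^sup>2 * lam / (2 * n)"
        using n by (simp_all add: power2_eq_square mult.commute mult.left_commute)
      then have "s * V - s\<^sup>2 * n / (2 * lam) = V\<^sup>2 * lam / (2 * n)"
        using pos by simp
      moreover have "\<eta>\<^sup>2 * lam / (2 * (2 * B)\<^sup>2) \<le> V\<^sup>2 * lam / (2 * n)"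
        using Vpos n n_le pos by (intro frac_le mult_mono power_mono) auto
      ultimately show ?thesis by (simp add: c_def)
    qed
    have "(1 - s) *\<^sub>R y + s *\<^sub>R v \<in> \<Omega>"
      using \<Omega>(2) y v s01 by (simp add: convex_alt)
    then show "z \<in> \<Omega>" by (simp add: z_eq s_def)
    show "\<phi> z \<le> \<phi> y - c" using c_le unfolding z \<phi> by simp
  qed
qed

lemma condg_terminates:
  fixes \<Omega> :: "'a::euclidean_space set" and u w :: 'a
  assumes \<Omega>: "compact \<Omega>" "convex \<Omega>" "u \<in> \<Omega>" and pos: "lam > 0" "\<eta> > 0"
    and run: "y 0 = u"
      "\<And>t. \<not> condg_gap \<Omega> w u lam (y t) \<le> \<eta> \<Longrightarrow>
         v t \<in> \<Omega> \<and> (w + (1 / lam) *\<^sub>R (y t - u)) \<bullet> (y t - v t) = condg_gap \<Omega> w u lam (y t) \<and>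
         y (Suc t) = (1 - condg_step w u lam (y t) (v t)) *\<^sub>R y t
                       + condg_step w u lam (y t) (v t) *\<^sub>R v t"
  shows "\<exists>t. condg_gap \<Omega> w u lam (y t) \<le> \<eta>"
proof (rule ccontr)
  assume "\<nexists>t. condg_gap \<Omega> w u lam (y t) \<le> \<eta>"
  then have nonstop: "\<And>t. \<not> condg_gap \<Omega> w u lam (y t) \<le> \<eta>" by blast
  define \<phi> where "\<phi> x = w \<bullet> x + (norm (x - u))\<^sup>2 / (2 * lam)" for x
  obtain c where "c > 0" and c: "\<forall>x\<in>\<Omega>. \<forall>v\<in>\<Omega>.
      (w + (1 / lam) *\<^sub>R (x - u)) \<bullet> (x - v) > \<eta> \<longrightarrow>
      (\<forall>z. z = (1 - condg_step w u lam x v) *\<^sub>R x + condg_step w u lam x v *\<^sub>R v \<longrightarrow>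
        z \<in> \<Omega> \<and> \<phi> z \<le> \<phi> x - c)"
    using condg_step_decrease[OF \<Omega> pos, of w] unfolding \<phi>_def by (elim exE conjE)
  have dec: "y t \<in> \<Omega> \<and> \<phi> (y t) \<le> \<phi> u - real t * c" for t
  proof (induction t)
    case 0
    then show ?case using run(1) \<Omega> by simp
  next
    case (Suc t)
    note step = run(2)[OF nonstop, of t]
    have "(w + (1 / lam) *\<^sub>R (y t - u)) \<bullet> (y t - v t) > \<eta>"
      using conjunct1[OF conjunct2[OF step]] nonstop[of t] by linarith
    then have "y (Suc t) \<in> \<Omega> \<and> \<phi> (y (Suc t)) \<le> \<phi> (y t) - c"
      by (rule c[rule_format, OF conjunct1[OF Suc] conjunct1[OF step] _ conjunct2[OF conjunct2[OF step]]])
    then show ?case using Suc by (simp add: algebra_simps)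
  qed
  obtain B where B: "\<And>x. x \<in> \<Omega> \<Longrightarrow> norm x \<le> B"
    using compact_imp_bounded[OF \<Omega>(1)] by (auto simp: bounded_pos)
  have lower: "- (norm w * B) \<le> \<phi> x" if "x \<in> \<Omega>" for x
  proof -
    have "\<bar>w \<bullet> x\<bar> \<le> norm w * norm x" by (rule Cauchy_Schwarz_ineq2)
    also have "\<dots> \<le> norm w * B" using B[OF that] by (simp add: mult_left_mono)
    finally have "- (norm w * B) \<le> w \<bullet> x" by simp
    moreover have "0 \<le> (norm (x - u))\<^sup>2 / (2 * lam)" using pos by simp
    ultimately show ?thesis by (simp add: \<phi>_def)
  qed
  obtain t :: nat where "real t * c > \<phi> u + norm w * B"
    using reals_Archimedean3[OF \<open>c > 0\<close>] by (elim allE exE)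
  then show False using dec[of t] lower[of "y t"] by linarith
qed

section \<open>The stochastic NCGS algorithm\<close>

text \<open>
  \<open>ncgs_run\<close> relates the samples \<open>xs k i\<close> drawn by the algorithm to the iterates of its
  first \<open>N\<close> iterations. The random stopping time \<open>R\<close> only decides which of them is
  returned.
\<close>

definition ncgs_run ::
  "'a::real_inner set \<Rightarrow> ('a \<Rightarrow> 's \<Rightarrow> 'a) \<Rightarrow> (nat \<Rightarrow> real) \<Rightarrow> (nat \<Rightarrow> real) \<Rightarrow> (nat \<Rightarrow> real) \<Rightarrow>
   (nat \<Rightarrow> real) \<Rightarrow> (nat \<Rightarrow> real) \<Rightarrow> (nat \<Rightarrow> nat) \<Rightarrow> 'a \<Rightarrow> nat \<Rightarrow> (nat \<Rightarrow> nat \<Rightarrow> 's) \<Rightarrow>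
   (nat \<Rightarrow> 'a) \<Rightarrow> (nat \<Rightarrow> 'a) \<Rightarrow> (nat \<Rightarrow> 'a) \<Rightarrow> (nat \<Rightarrow> 'a) \<Rightarrow> bool" where
  "ncgs_run \<Omega> G \<alpha> lam \<beta> \<eta> chi m \<theta>0 N xs \<theta> \<theta>ag \<theta>md Gbar \<longleftrightarrow>
     \<theta> 0 = \<theta>0 \<and> \<theta>ag 0 = \<theta>0 \<and>
     (\<forall>k\<in>{1..N}.
        \<theta>md k = (1 - \<alpha> k) *\<^sub>R \<theta>ag (k - 1) + \<alpha> k *\<^sub>R \<theta> (k - 1) \<and>
        Gbar k = (1 / real (m k)) *\<^sub>R (\<Sum>i=1..m k. G (\<theta>md k) (xs k i)) \<and>
        condg \<Omega> (Gbar k) (\<theta> (k - 1)) (lam k) (\<eta> k) (\<theta> k) \<and>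
        condg \<Omega> (Gbar k) (\<theta>md k) (\<beta> k) (chi k) (\<theta>ag k))"

text \<open>The sigma-algebra generated by the samples of the first \<open>k\<close> iterations.\<close>

definition sample_history ::
  "'w measure \<Rightarrow> 's measure \<Rightarrow> (nat \<Rightarrow> nat \<Rightarrow> 'w \<Rightarrow> 's) \<Rightarrow> (nat \<Rightarrow> nat) \<Rightarrow> nat \<Rightarrow> 'w measure" where
  "sample_history Q P \<xi> m k =
     sigma (space Q) (\<Union>j\<in>{1..k}. \<Union>i\<in>{1..m j}. {\<xi> j i -` A \<inter> space Q |A. A \<in> sets P})"

end

theory Submission
  imports Defs
begin

text \<open>
  Write \<open>x\<close>, \<open>y\<close>, \<open>z\<close> for \<open>\<theta>\<close>, \<open>\<theta>ag\<close>, \<open>\<theta>md\<close> and \<open>\<delta> k\<close> for the gradient error at iteration \<open>k\<close>.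
  Testing the stopping rule of the second \<open>condg\<close> call at \<open>(1 - \<alpha> k) y (k - 1) + \<alpha> k x k\<close> and that of
  the first one at \<open>\<theta>star\<close> gives, together with the upper and lower quadratic bounds on \<open>F\<close> around
  \<open>z k\<close>, a recursion for \<open>F (y k) - F \<theta>star\<close> with contraction factor \<open>1 - \<alpha> k\<close> and a gain of
  \<open>L / 4\<close> times the squared distance from \<open>y k\<close> to \<open>z k\<close>. Multiplied by \<open>1 / \<Gamma> k = k (k + 1) / 2\<close> it
  telescopes, because \<open>\<alpha> k / (lam k * \<Gamma> k) = 4 * L\<close> does not depend on \<open>k\<close>. In expectation the term
  linear in \<open>\<delta> k\<close> vanishes, as \<open>x (k - 1)\<close> and \<open>z k\<close> depend on earlier samples only, and the
  quadratic one is at most \<open>\<sigma>\<^sup>2 / k\<close>. Finally \<open>y k\<close> approximates the exact proximal point, so the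
  squared gradient mapping is at most \<open>8 L\<^sup>2\<close> times the squared distance from \<open>y k\<close> to \<open>z k\<close> plus
  \<open>4 L / N\<close>.
\<close>

section \<open>Conditional gradient steps and projections\<close>

text \<open>Law of cosines at the vertex \<open>a\<close>. It turns the linear term of a stopping
  test into squared distances, which can be telescoped.\<close>

lemma power2_norm_diff_sum:
  fixes a b c :: "'a::real_inner"
  shows "2 * ((a - b) \<bullet> (a - c)) = (norm (a - b))\<^sup>2 + (norm (a - c))\<^sup>2 - (norm (b - c))\<^sup>2"
  unfolding power2_norm_eq_inner by (simp add: inner_simps inner_commute algebra_simps)

text \<open>The gap is a supremum of reals, so it dominates the individual values only once they are
  known to be bounded above. Compactness supplies that bound.\<close>

lemma inner_le_condg_gap:
  assumes "compact \<Omega>" "x \<in> \<Omega>"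
  shows "(w + (1 / lam) *\<^sub>R (y - u)) \<bullet> (y - x) \<le> condg_gap \<Omega> w u lam y"
  unfolding condg_gap_def
proof (rule cSUP_upper[OF assms(2)])
  have "compact ((\<lambda>x. (w + (1 / lam) *\<^sub>R (y - u)) \<bullet> (y - x)) ` \<Omega>)"
    by (intro compact_continuous_image assms continuous_intros)
  then show "bdd_above ((\<lambda>x. (w + (1 / lam) *\<^sub>R (y - u)) \<bullet> (y - x)) ` \<Omega>)"
    by (intro bounded_imp_bdd_above compact_imp_bounded)
qed

lemma condg_in_domain:
  fixes \<Omega> :: "'a::euclidean_space set"
  assumes \<Omega>: "compact \<Omega>" "convex \<Omega>" "u \<in> \<Omega>" and pos: "lam > 0" "\<eta> > 0"
    and y: "condg \<Omega> w u lam \<eta> y"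
  shows "y \<in> \<Omega>"
proof -
  have "condg_iterate \<Omega> w u lam \<eta> y" using y by (simp add: condg_def)
  then show ?thesis
  proof induction
    case start
    show ?case by (rule \<Omega>(3))
  next
    \<comment> \<open>The negated stopping test says that the chosen \<open>v\<close> has gap value
      above \<open>\<eta>\<close>, which is what \<open>condg_step_decrease\<close> needs to keep
      the next iterate in the domain.\<close>
    case (step y v s)
    then show ?case using condg_step_decrease[OF \<Omega> pos, of w] by (metis linorder_not_le)
  qed
qed

lemma condg_inner_le:
  assumes "compact \<Omega>" "condg \<Omega> w u lam \<eta> y" "x \<in> \<Omega>"
  shows "(w + (1 / lam) *\<^sub>R (y - u)) \<bullet> (y - x) \<le> \<eta>"
  by (rule order_trans[OF inner_le_condg_gap[OF assms(1,3)]]) (use assms(2) in \<open>simp add: condg_def\<close>)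

text \<open>The stopping test rewritten by the law of cosines. With \<open>\<eta> = 0\<close> this
  is the three-point inequality of an exact proximal step; inexactness costs only the summand
  \<open>\<eta>\<close>.\<close>

lemma condg_three_point:
  assumes "compact \<Omega>" "condg \<Omega> w u lam \<eta> y" "x \<in> \<Omega>" "lam > 0"
  shows "w \<bullet> (y - x) \<le> \<eta> + ((norm (u - x))\<^sup>2 - (norm (y - x))\<^sup>2 - (norm (y - u))\<^sup>2) / (2 * lam)"
proof -
  have "(w + (1 / lam) *\<^sub>R (y - u)) \<bullet> (y - x) = w \<bullet> (y - x) + (2 * ((y - u) \<bullet> (y - x))) / (2 * lam)"
    using assms(4) by (simp add: inner_add_left)
  also have "\<dots> = w \<bullet> (y - x)
      - ((norm (u - x))\<^sup>2 - (norm (y - x))\<^sup>2 - (norm (y - u))\<^sup>2) / (2 * lam)"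
    unfolding power2_norm_diff_sum using assms(4) by (simp add: field_simps)
  finally show ?thesis using condg_inner_le[OF assms(1-3)] by linarith
qed

text \<open>Completing the square: the proximal objective is a constant plus the squared distance to
  \<open>x - \<gamma> *\<^sub>R w\<close> divided by \<open>2 * \<gamma>\<close>. The projection
  brings a variational inequality and continuity, which the choice in \<open>arg_min_on\<close> does
  not show.\<close>

lemma prox_pt_eq_closest_point:
  fixes \<Omega> :: "'a::euclidean_space set"
  assumes \<Omega>: "closed \<Omega>" "convex \<Omega>" "\<Omega> \<noteq> {}" and \<gamma>: "\<gamma> > 0"
  shows "prox_pt \<Omega> x w \<gamma> = closest_point \<Omega> (x - \<gamma> *\<^sub>R w)"
proof -
  define a where "a = x - \<gamma> *\<^sub>R w"
  define \<phi> where "\<phi> y = w \<bullet> y + 1 / (2 * \<gamma>) * (norm (y - x))\<^sup>2" for y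
  define c where "c = w \<bullet> x - \<gamma> / 2 * (norm w)\<^sup>2"
  have \<phi>: "\<phi> y = c + (dist a y)\<^sup>2 / (2 * \<gamma>)" for y
  proof -
    have "dist a y = norm ((y - x) + \<gamma> *\<^sub>R w)"
      unfolding a_def dist_norm by (subst norm_minus_commute) (simp add: algebra_simps)
    then have "(dist a y)\<^sup>2 = (norm (y - x))\<^sup>2 + 2 * \<gamma> * (w \<bullet> (y - x)) + \<gamma>\<^sup>2 * (norm w)\<^sup>2"
      by (simp only: power2_norm_eq_inner)
         (simp add: inner_add_left inner_add_right inner_commute power2_eq_square distrib_left mult.assoc)
    then show ?thesis using \<gamma>
      by (simp add: \<phi>_def c_def inner_diff_right power2_eq_square field_simps)
  qed
  have mono: "\<phi> y < \<phi> z \<longleftrightarrow> dist a y < dist a z" for y z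
  proof -
    have "\<phi> y < \<phi> z \<longleftrightarrow> (dist a y)\<^sup>2 < (dist a z)\<^sup>2"
      using \<gamma> by (simp add: \<phi> divide_less_cancel)
    also have "\<dots> \<longleftrightarrow> dist a y < dist a z" by (simp add: linorder_not_le[symmetric])
    finally show ?thesis .
  qed
  \<comment> \<open>A minimiser has to be exhibited first; only then does the choice operator inside
    \<open>prox_pt\<close> return one.\<close>
  have "is_arg_min \<phi> (\<lambda>y. y \<in> \<Omega>) (closest_point \<Omega> a)"
    unfolding is_arg_min_def mono
    using closest_point_exists[OF \<Omega>(1,3), of a] by (auto simp: not_less)
  then have "is_arg_min \<phi> (\<lambda>y. y \<in> \<Omega>) (prox_pt \<Omega> x w \<gamma>)"
    unfolding prox_pt_def arg_min_on_def arg_min_def \<phi>_def[symmetric, abs_def] by (rule someI)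
  then show ?thesis
    unfolding is_arg_min_def mono a_def[symmetric]
    by (intro closest_point_unique[OF \<Omega>(2,1)]) (auto simp: not_less)
qed

text \<open>Lets a bound on all proximal points be read as a bound on \<open>\<Omega>\<close>
  itself.\<close>

lemma prox_pt_zero:
  fixes \<Omega> :: "'a::euclidean_space set"
  assumes "closed \<Omega>" "convex \<Omega>" "x \<in> \<Omega>" "\<gamma> > 0"
  shows "prox_pt \<Omega> x 0 \<gamma> = x"
proof -
  have "prox_pt \<Omega> x 0 \<gamma> = closest_point \<Omega> (x - \<gamma> *\<^sub>R 0)"
    using assms by (intro prox_pt_eq_closest_point) auto
  then show ?thesis using assms by (simp add: closest_point_self)
qed

text \<open>Let \<open>q\<close> be the exact proximal point. Add the obtuse-angle inequality of the
  projection, tested at \<open>y\<close>, to \<open>\<beta>\<close> times the stopping test at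
  \<open>q\<close>: \<open>w\<close> and \<open>z\<close> cancel, and the squared distance from
  \<open>y\<close> to \<open>q\<close> is at most \<open>\<beta> * \<eta>\<close>. The triangle
  inequality then passes from \<open>q\<close> to \<open>y\<close>.\<close>

lemma grad_mapping_condg_bound:
  fixes \<Omega> :: "'a::euclidean_space set"
  assumes \<Omega>: "compact \<Omega>" "convex \<Omega>" and z: "z \<in> \<Omega>" and \<beta>: "\<beta> > 0" and pos: "\<eta> > 0"
    and y: "condg \<Omega> w z \<beta> \<eta> y"
  shows "(norm (grad_mapping \<Omega> z w \<beta>))\<^sup>2 \<le> 2 / \<beta>\<^sup>2 * (norm (y - z))\<^sup>2 + 2 * \<eta> / \<beta>"
proof -
  define q where "q = prox_pt \<Omega> z w \<beta>"
  have cl: "closed \<Omega>" using \<Omega>(1) by (rule compact_imp_closed)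
  have q: "q = closest_point \<Omega> (z - \<beta> *\<^sub>R w)"
    unfolding q_def using cl \<Omega> z \<beta> by (intro prox_pt_eq_closest_point) auto
  have q_in: "q \<in> \<Omega>" unfolding q using cl z by (intro closest_point_in_set) auto
  have y_in: "y \<in> \<Omega>" by (rule condg_in_domain[OF \<Omega> z \<beta> pos y])
  have "(z - \<beta> *\<^sub>R w - q) \<bullet> (y - q) \<le> 0"
    unfolding q by (rule closest_point_dot[OF \<Omega>(2) cl y_in])
  moreover have "\<beta> * ((w + (1 / \<beta>) *\<^sub>R (y - z)) \<bullet> (y - q)) \<le> \<beta> * \<eta>"
    using condg_inner_le[OF \<Omega>(1) y q_in] \<beta> by (intro mult_left_mono) auto
  moreover have "\<beta> * ((w + (1 / \<beta>) *\<^sub>R (y - z)) \<bullet> (y - q)) = (\<beta> *\<^sub>R w + (y - z)) \<bullet> (y - q)"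
    using \<beta> by (simp add: inner_add_left distrib_left)
  moreover have "(z - \<beta> *\<^sub>R w - q) \<bullet> (y - q) + (\<beta> *\<^sub>R w + (y - z)) \<bullet> (y - q) = (norm (y - q))\<^sup>2"
    unfolding power2_norm_eq_inner by (simp add: inner_add_left[symmetric])
  ultimately have yq: "(norm (y - q))\<^sup>2 \<le> \<beta> * \<eta>" by linarith
  have "norm (z - q) \<le> norm (y - z) + norm (y - q)"
    using norm_triangle_ineq4[of "y - q" "y - z"] by simp
  then have "(norm (z - q))\<^sup>2 \<le> (norm (y - z) + norm (y - q))\<^sup>2" by (intro power_mono) auto
  also have "\<dots> \<le> 2 * (norm (y - z))\<^sup>2 + 2 * (norm (y - q))\<^sup>2"
    using zero_le_power2[of "norm (y - z) - norm (y - q)"] by (simp add: power2_eq_square algebra_simps)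
  also have "\<dots> \<le> 2 * (norm (y - z))\<^sup>2 + 2 * (\<beta> * \<eta>)" using yq by simp
  finally have "(norm (z - q))\<^sup>2 / \<beta>\<^sup>2 \<le> (2 * (norm (y - z))\<^sup>2 + 2 * (\<beta> * \<eta>)) / \<beta>\<^sup>2"
    by (intro divide_right_mono) auto
  also have "\<dots> = 2 / \<beta>\<^sup>2 * (norm (y - z))\<^sup>2 + 2 * \<eta> / \<beta>"
    using \<beta> by (simp add: field_simps power2_eq_square)
  finally show ?thesis
    using \<beta> by (simp add: grad_mapping_def q_def[symmetric] power_divide)
qed

section \<open>One iteration\<close>

lemma has_real_derivative_along_line:
  fixes F :: "'a::euclidean_space \<Rightarrow> real"
  assumes "F differentiable (at (x + t *\<^sub>R h))"
  shows "((\<lambda>t. F (x + t *\<^sub>R h)) has_real_derivative grad F (x + t *\<^sub>R h) \<bullet> h) (at t)"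
proof -
  have F': "(F has_derivative (\<lambda>v. v \<bullet> grad F (x + t *\<^sub>R h))) (at (x + t *\<^sub>R h))"
    using GDERIV_grad[OF assms] by (simp add: gderiv_def)
  have "((\<lambda>t. F (x + t *\<^sub>R h)) has_derivative (\<lambda>s. (s *\<^sub>R h) \<bullet> grad F (x + t *\<^sub>R h))) (at t)"
    by (rule has_derivative_compose[where g = F and f = "\<lambda>t. x + t *\<^sub>R h" and x = t, OF _ F'])
       (auto intro!: derivative_eq_intros)
  then show ?thesis
    by (simp add: has_field_derivative_def inner_commute mult_commute_abs)
qed

text \<open>The descent lemma by monotonicity: the auxiliary \<open>\<phi>\<close> has nonpositive
  derivative on the unit interval. The Lipschitz bound holds on \<open>\<Omega>\<close> only, and
  convexity keeps the segment there.\<close>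

lemma smooth_on_upper_bound:
  fixes F :: "'a::euclidean_space \<Rightarrow> real"
  assumes "convex \<Omega>" and diff: "\<And>x. F differentiable (at x)" and smooth: "smooth_on L F \<Omega>"
    and x: "x \<in> \<Omega>" and y: "y \<in> \<Omega>"
  shows "F y \<le> F x + grad F x \<bullet> (y - x) + L / 2 * (norm (y - x))\<^sup>2"
proof -
  define h where "h = y - x"
  define \<phi> where "\<phi> t = F (x + t *\<^sub>R h) - t * (grad F x \<bullet> h) - L / 2 * t\<^sup>2 * (norm h)\<^sup>2" for t
  have der: "(\<phi> has_real_derivative
      grad F (x + t *\<^sub>R h) \<bullet> h - grad F x \<bullet> h - L * t * (norm h)\<^sup>2) (at t)" for t
    unfolding \<phi>_def
    by (auto intro!: derivative_eq_intros has_real_derivative_along_line diff)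
  have "\<phi> 1 \<le> \<phi> 0"
  proof (rule DERIV_nonpos_imp_nonincreasing[where f = \<phi> and a = 0 and b = 1])
    fix t :: real assume t: "0 \<le> t" "t \<le> 1"
    have "x + t *\<^sub>R h = (1 - t) *\<^sub>R x + t *\<^sub>R y" by (simp add: h_def algebra_simps)
    then have "x + t *\<^sub>R h \<in> \<Omega>" using assms(1) x y t by (simp add: convex_alt)
    then have "norm (grad F (x + t *\<^sub>R h) - grad F x) \<le> L * norm (t *\<^sub>R h)"
      using smooth x unfolding smooth_on_def by (metis add_diff_cancel_left')
    then have "norm (grad F (x + t *\<^sub>R h) - grad F x) * norm h \<le> L * norm (t *\<^sub>R h) * norm h"
      by (rule mult_right_mono) simp
    moreover have "(grad F (x + t *\<^sub>R h) - grad F x) \<bullet> h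
        \<le> norm (grad F (x + t *\<^sub>R h) - grad F x) * norm h"
      by (rule norm_cauchy_schwarz)
    ultimately have "grad F (x + t *\<^sub>R h) \<bullet> h - grad F x \<bullet> h - L * t * (norm h)\<^sup>2 \<le> 0"
      using t by (simp add: inner_diff_left power2_eq_square mult.assoc)
    with der show "\<exists>d. (\<phi> has_real_derivative d) (at t) \<and> d \<le> 0" by blast
  qed simp
  then show ?thesis by (simp add: \<phi>_def h_def)
qed

text \<open>The gradient error \<open>w - grad F z\<close> is split. Its part against
  \<open>y1 - z\<close>, which depends on the same samples, is paid for quadratically by Young's
  inequality with free weight \<open>c\<close>, at the expense of the gain on the left. Its part
  against \<open>x0 - u\<close> stays linear, so that it can vanish in the mean.\<close>

lemma ncgs_step_bound:
  fixes \<Omega> :: "'a::euclidean_space set" and F :: "'a \<Rightarrow> real"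
  assumes \<Omega>: "compact \<Omega>" "convex \<Omega>"
    and diff: "\<And>x. F differentiable (at x)"
    and smooth: "smooth_on L F \<Omega>" and lower: "lower_smooth_on l F \<Omega>"
    and pts: "x0 \<in> \<Omega>" "y0 \<in> \<Omega>" "x1 \<in> \<Omega>" "y1 \<in> \<Omega>" "u \<in> \<Omega>"
    and \<alpha>: "0 \<le> \<alpha>" "\<alpha> \<le> 1" and pos: "lam > 0" "\<beta> > 0" "c > 0" and step: "\<alpha> * lam \<le> \<beta>"
    and z: "z = (1 - \<alpha>) *\<^sub>R y0 + \<alpha> *\<^sub>R x0"
    and x1: "condg \<Omega> w x0 lam \<eta> x1" and y1: "condg \<Omega> w z \<beta> \<eta> y1"
  shows "F y1 - F u + (1 / (2 * \<beta>) - L / 2 - c / 2) * (norm (y1 - z))\<^sup>2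
    \<le> (1 - \<alpha>) * (F y0 - F u) + (1 + \<alpha>) * \<eta>
      + \<alpha> / (2 * lam) * ((norm (x0 - u))\<^sup>2 - (norm (x1 - u))\<^sup>2)
      + l / 2 * ((1 - \<alpha>) * (norm (z - y0))\<^sup>2 + \<alpha> * (norm (z - u))\<^sup>2)
      + (norm (w - grad F z))\<^sup>2 / (2 * c) - \<alpha> * ((x0 - u) \<bullet> (w - grad F z))"
proof -
  \<comment> \<open>The formula for \<open>z\<close> with \<open>x0\<close> replaced by
    \<open>x1\<close>. Its distance to \<open>z\<close> carries a factor \<open>\<alpha>\<close>,
    and \<open>x1\<close> cancels in \<open>y1 - v + \<alpha> *\<^sub>R (x1 - u)\<close>.\<close>
  define v where "v = (1 - \<alpha>) *\<^sub>R y0 + \<alpha> *\<^sub>R x1"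
  define D where "D = grad F z"
  have z_in: "z \<in> \<Omega>" unfolding z using \<Omega>(2) pts \<alpha> by (simp add: convex_alt)
  have v_in: "v \<in> \<Omega>" unfolding v_def using \<Omega>(2) pts \<alpha> by (simp add: convex_alt)
  have zv: "norm (z - v) = \<alpha> * norm (x1 - x0)"
  proof -
    have "z - v = (- \<alpha>) *\<^sub>R (x1 - x0)" by (simp add: z v_def algebra_simps)
    then show ?thesis using \<alpha> by simp
  qed
  have "\<alpha> * (w \<bullet> (x1 - u))
      \<le> \<alpha> * (\<eta> + ((norm (x0 - u))\<^sup>2 - (norm (x1 - u))\<^sup>2 - (norm (x1 - x0))\<^sup>2) / (2 * lam))"
    using condg_three_point[OF \<Omega>(1) x1 pts(5) pos(1)] \<alpha>(1) by (rule mult_left_mono)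
  also have "\<dots> = \<alpha> * \<eta> + \<alpha> / (2 * lam) * ((norm (x0 - u))\<^sup>2 - (norm (x1 - u))\<^sup>2)
      - \<alpha> / (2 * lam) * (norm (x1 - x0))\<^sup>2"
    using pos by (simp add: field_simps)
  finally have 1: "\<alpha> * (w \<bullet> (x1 - u)) \<le> \<dots>" .
  have "w \<bullet> (y1 - v) \<le> \<eta> + ((norm (z - v))\<^sup>2 - (norm (y1 - v))\<^sup>2 - (norm (y1 - z))\<^sup>2) / (2 * \<beta>)"
    by (rule condg_three_point[OF \<Omega>(1) y1 v_in pos(2)])
  also have "\<dots> \<le> \<eta> + ((norm (z - v))\<^sup>2 - (norm (y1 - z))\<^sup>2) / (2 * \<beta>)"
    using pos by (intro add_left_mono divide_right_mono) auto
  also have "\<dots> = \<eta> + \<alpha>\<^sup>2 / (2 * \<beta>) * (norm (x1 - x0))\<^sup>2 - 1 / (2 * \<beta>) * (norm (y1 - z))\<^sup>2"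
    unfolding zv by (simp add: power_mult_distrib diff_divide_distrib)
  finally have 2: "w \<bullet> (y1 - v) \<le> \<dots>" .
  \<comment> \<open>The cost of testing the second call at \<open>v\<close> is absorbed by the
    negative term in \<open>x1 - x0\<close> from the first call; this is where
    \<open>\<alpha> * lam \<le> \<beta>\<close> enters.\<close>
  have 3: "\<alpha>\<^sup>2 / (2 * \<beta>) * (norm (x1 - x0))\<^sup>2 \<le> \<alpha> / (2 * lam) * (norm (x1 - x0))\<^sup>2"
  proof (rule mult_right_mono)
    show "\<alpha>\<^sup>2 / (2 * \<beta>) \<le> \<alpha> / (2 * lam)"
      using mult_left_mono[OF step \<alpha>(1)] pos by (simp add: field_simps power2_eq_square)
  qed simp
  have F1: "F y1 \<le> F z + D \<bullet> (y1 - z) + L / 2 * (norm (y1 - z))\<^sup>2"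
    unfolding D_def by (rule smooth_on_upper_bound[OF \<Omega>(2) diff smooth z_in pts(4)])
  \<comment> \<open>Lower smoothness around \<open>z\<close> stands in for the gradient inequality
    of a convex function; the excess is the term with \<open>l\<close>.\<close>
  have low: "F z \<le> F x + D \<bullet> (z - x) + l / 2 * (norm (z - x))\<^sup>2" if "x \<in> \<Omega>" for x
    using lower[unfolded lower_smooth_on_def, rule_format, OF that z_in]
    by (simp add: D_def norm_minus_commute inner_diff_right)
  have "(1 - \<alpha>) * F z \<le> (1 - \<alpha>) * (F y0 + D \<bullet> (z - y0) + l / 2 * (norm (z - y0))\<^sup>2)"
    using low[OF pts(2)] \<alpha> by (intro mult_left_mono) auto
  moreover have "\<alpha> * F z \<le> \<alpha> * (F u + D \<bullet> (z - u) + l / 2 * (norm (z - u))\<^sup>2)"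
    using low[OF pts(5)] \<alpha> by (intro mult_left_mono) auto
  moreover have "F z = (1 - \<alpha>) * F z + \<alpha> * F z" by (simp add: algebra_simps)
  ultimately have "F z \<le> (1 - \<alpha>) * (F y0 + D \<bullet> (z - y0) + l / 2 * (norm (z - y0))\<^sup>2)
      + \<alpha> * (F u + D \<bullet> (z - u) + l / 2 * (norm (z - u))\<^sup>2)" by linarith
  then have F2: "F z \<le> (1 - \<alpha>) * F y0 + \<alpha> * F u
      + ((1 - \<alpha>) * (D \<bullet> (z - y0)) + \<alpha> * (D \<bullet> (z - u)))
      + l / 2 * ((1 - \<alpha>) * (norm (z - y0))\<^sup>2 + \<alpha> * (norm (z - u))\<^sup>2)"
    by (simp add: algebra_simps diff_divide_distrib)
  \<comment> \<open>Both \<open>(y1 - v) + \<alpha> *\<^sub>R (x1 - u)\<close> and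
    \<open>(y1 - z) + \<alpha> *\<^sub>R (x0 - u)\<close> equal
    \<open>y1 - (1 - \<alpha>) *\<^sub>R y0 - \<alpha> *\<^sub>R u\<close>. So \<open>w\<close> is
    used on the first form and the error \<open>w - D\<close> on the second.\<close>
  have lin: "D \<bullet> (y1 - z) + ((1 - \<alpha>) * (D \<bullet> (z - y0)) + \<alpha> * (D \<bullet> (z - u)))
      = w \<bullet> (y1 - v) + \<alpha> * (w \<bullet> (x1 - u)) - (w - D) \<bullet> (y1 - z) - \<alpha> * ((x0 - u) \<bullet> (w - D))"
    unfolding z v_def by (simp add: inner_simps inner_commute algebra_simps)
  have "- ((w - D) \<bullet> (y1 - z)) \<le> norm (w - D) * norm (y1 - z)"
    using Cauchy_Schwarz_ineq2[of "w - D" "y1 - z"] by linarith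
  also have "\<dots> \<le> (norm (w - D))\<^sup>2 / (2 * c) + c / 2 * (norm (y1 - z))\<^sup>2"
    using zero_le_power2[of "norm (w - D) - c * norm (y1 - z)"] pos
    by (simp add: power2_eq_square field_simps)
  finally have young: "- ((w - D) \<bullet> (y1 - z)) \<le> \<dots>" .
  have "F y1 - F u + (1 / (2 * \<beta>) - L / 2 - c / 2) * (norm (y1 - z))\<^sup>2
      = F y1 - F u + 1 / (2 * \<beta>) * (norm (y1 - z))\<^sup>2 - L / 2 * (norm (y1 - z))\<^sup>2
        - c / 2 * (norm (y1 - z))\<^sup>2"
    by (simp only: left_diff_distrib)
  moreover have "(1 - \<alpha>) * (F y0 - F u) = (1 - \<alpha>) * F y0 + \<alpha> * F u - F u"
    by (simp add: algebra_simps)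
  moreover have "(1 + \<alpha>) * \<eta> = \<eta> + \<alpha> * \<eta>" by (simp add: algebra_simps)
  ultimately show ?thesis
    using 1 2 3 F1 F2 lin young unfolding D_def[symmetric] by linarith
qed

section \<open>Summing over the iterations\<close>

lemma ncgs_runD:
  assumes "ncgs_run \<Omega> G \<alpha> lam \<beta> \<eta> chi m \<theta>0 N xs x y z g" "k \<in> {1..N}"
  shows "z k = (1 - \<alpha> k) *\<^sub>R y (k - 1) + \<alpha> k *\<^sub>R x (k - 1)"
    and "g k = (1 / real (m k)) *\<^sub>R (\<Sum>i=1..m k. G (z k) (xs k i))"
    and "condg \<Omega> (g k) (x (k - 1)) (lam k) (\<eta> k) (x k)"
    and "condg \<Omega> (g k) (z k) (\<beta> k) (chi k) (y k)"
  using assms unfolding ncgs_run_def by blast+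

lemma ncgs_run_in_domain:
  fixes \<Omega> :: "'a::euclidean_space set"
  assumes \<Omega>: "compact \<Omega>" "convex \<Omega>" "\<theta>0 \<in> \<Omega>"
    and run: "ncgs_run \<Omega> G \<alpha> lam \<beta> \<eta> chi m \<theta>0 N xs x y z g"
    and \<alpha>: "\<And>k. k \<in> {1..N} \<Longrightarrow> 0 \<le> \<alpha> k \<and> \<alpha> k \<le> 1"
    and pos: "\<And>k. k \<in> {1..N} \<Longrightarrow> lam k > 0 \<and> \<beta> k > 0 \<and> \<eta> k > 0 \<and> chi k > 0"
  shows "k \<le> N \<Longrightarrow> x k \<in> \<Omega> \<and> y k \<in> \<Omega>"
    and "k \<in> {1..N} \<Longrightarrow> z k \<in> \<Omega>"
proof -
  have z: "z k \<in> \<Omega>" if "k \<in> {1..N}" "x (k - 1) \<in> \<Omega>" "y (k - 1) \<in> \<Omega>" for k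
  proof -
    have "z k = (1 - \<alpha> k) *\<^sub>R y (k - 1) + \<alpha> k *\<^sub>R x (k - 1)"
      by (rule ncgs_runD(1)[OF run that(1)])
    then show ?thesis using \<Omega>(2) \<alpha>[OF that(1)] that(2,3) by (simp add: convex_alt)
  qed
  have xy: "x k \<in> \<Omega> \<and> y k \<in> \<Omega>" if "k \<le> N" for k
    using that
  proof (induction k)
    case 0
    then show ?case using run \<Omega>(3) by (simp add: ncgs_run_def)
  next
    case (Suc k)
    then have k: "Suc k \<in> {1..N}" and prev: "x k \<in> \<Omega>" "y k \<in> \<Omega>" by auto
    have "condg \<Omega> (g (Suc k)) (x k) (lam (Suc k)) (\<eta> (Suc k)) (x (Suc k))"
      and "condg \<Omega> (g (Suc k)) (z (Suc k)) (\<beta> (Suc k)) (chi (Suc k)) (y (Suc k))"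
      using ncgs_runD(3,4)[OF run k] by simp_all
    moreover have "z (Suc k) \<in> \<Omega>" using z[OF k] prev by simp
    ultimately show ?case
      using condg_in_domain[OF \<Omega>(1,2)] prev(1) pos[OF k] by blast
  qed
  then show "k \<le> N \<Longrightarrow> x k \<in> \<Omega> \<and> y k \<in> \<Omega>" .
  show "z k \<in> \<Omega>" if "k \<in> {1..N}"
    using z[OF that] xy[of "k - 1"] that by auto
qed

text \<open>Since \<open>z - y = \<alpha> *\<^sub>R (x - y)\<close>, the first square carries
  \<open>\<alpha>\<^sup>2\<close>, which offsets the quadratic weight and leaves a coefficient of at
  most 2. The second carries a single \<open>\<alpha>\<close> and keeps the factor
  \<open>real k\<close>.\<close>

lemma lower_smooth_error_bound:
  fixes x y z u :: "'a::real_inner"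
  assumes M: "norm x \<le> M" "norm y \<le> M" "norm z \<le> M"
    and \<alpha>: "\<alpha> = 2 / (real k + 1)" and z: "z = (1 - \<alpha>) *\<^sub>R y + \<alpha> *\<^sub>R x"
  shows "real k * (real k + 1) / 2 * ((1 - \<alpha>) * (norm (z - y))\<^sup>2 + \<alpha> * (norm (z - u))\<^sup>2)
    \<le> 8 * M\<^sup>2 + real k * (2 * ((norm u)\<^sup>2 + M\<^sup>2))"
proof -
  have "z - y = \<alpha> *\<^sub>R (x - y)" by (simp add: z algebra_simps)
  then have zy: "norm (z - y) = \<alpha> * norm (x - y)" using \<alpha> by simp
  have "norm (x - y) \<le> 2 * M" using M norm_triangle_ineq4[of x y] by linarith
  then have xy: "(norm (x - y))\<^sup>2 \<le> 4 * M\<^sup>2"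
    using power_mono[of "norm (x - y)" "2 * M" 2] by (simp add: power_mult_distrib)
  have "norm (z - u) \<le> M + norm u" using M norm_triangle_ineq4[of z u] by linarith
  then have "(norm (z - u))\<^sup>2 \<le> (M + norm u)\<^sup>2" by (rule power_mono) simp
  also have "\<dots> \<le> 2 * ((norm u)\<^sup>2 + M\<^sup>2)"
    using zero_le_power2[of "M - norm u"] by (simp add: power2_eq_square algebra_simps)
  finally have zu: "(norm (z - u))\<^sup>2 \<le> 2 * ((norm u)\<^sup>2 + M\<^sup>2)" .
  have "real k * (real k + 1) / 2 * ((1 - \<alpha>) * (norm (z - y))\<^sup>2 + \<alpha> * (norm (z - u))\<^sup>2)
      = 2 * (real k * (real k - 1) / (real k + 1)\<^sup>2) * (norm (x - y))\<^sup>2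
        + real k * (norm (z - u))\<^sup>2"
  proof -
    have "real k + 1 \<noteq> 0" by linarith
    have "real k * (real k + 1) / 2 * ((1 - \<alpha>) * \<alpha>\<^sup>2) = 2 * (real k * (real k - 1) / (real k + 1)\<^sup>2)"
      unfolding \<alpha> using \<open>real k + 1 \<noteq> 0\<close> by (simp add: divide_simps power2_eq_square)
    moreover have "real k * (real k + 1) / 2 * \<alpha> = real k"
      unfolding \<alpha> using \<open>real k + 1 \<noteq> 0\<close> by (simp add: divide_simps)
    ultimately show ?thesis
      unfolding zy power_mult_distrib by (simp only: distrib_left mult.assoc[symmetric])
  qed
  moreover have "real k * (real k - 1) \<le> (real k + 1)\<^sup>2"
    by (simp add: power2_eq_square algebra_simps)
  then have "real k * (real k - 1) / (real k + 1)\<^sup>2 \<le> 1"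
    by (simp add: divide_le_eq_1)
  then have "2 * (real k * (real k - 1) / (real k + 1)\<^sup>2) * (norm (x - y))\<^sup>2 \<le> 2 * (norm (x - y))\<^sup>2"
    by (intro mult_right_mono) (linarith, simp)
  moreover have "real k * (norm (z - u))\<^sup>2 \<le> real k * (2 * ((norm u)\<^sup>2 + M\<^sup>2))"
    using zu by (intro mult_left_mono) auto
  ultimately show ?thesis using xy by linarith
qed

lemma sum_of_nat_real: "(\<Sum>k=1..N. real k) = real N * (real N + 1) / 2"
  by (induction N) (auto simp: field_simps)

lemma sum_triangular_real:
  "(\<Sum>k=1..N. real k * (real k + 1) / 2) = real N * (real N + 1) * (real N + 2) / 6"
  by (induction N) (auto simp: field_simps)

text \<open>A bound along a single path, without probability. The two noise sums are left explicit,
  as their expectations are handled differently.\<close>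

lemma ncgs_sum_bound:
  fixes \<Omega> :: "'a::euclidean_space set" and F :: "'a \<Rightarrow> real"
  assumes \<Omega>: "compact \<Omega>" "convex \<Omega>" "\<theta>0 \<in> \<Omega>" and L: "L > 0" and l: "l \<ge> 0" and N: "N \<ge> 1"
    and diff: "\<And>x. F differentiable (at x)"
    and smooth: "smooth_on L F \<Omega>" and lower: "lower_smooth_on l F \<Omega>"
    and M: "\<And>x. x \<in> \<Omega> \<Longrightarrow> norm x \<le> M"
    and u: "u \<in> \<Omega>" "\<And>x. x \<in> \<Omega> \<Longrightarrow> F u \<le> F x"
    and \<alpha>: "\<And>k. k \<in> {1..N} \<Longrightarrow> \<alpha> k = 2 / (real k + 1)"
    and \<beta>: "\<And>k. k \<in> {1..N} \<Longrightarrow> \<beta> k = 1 / (2 * L)"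
    and lam: "\<And>k. k \<in> {1..N} \<Longrightarrow> lam k = real k * \<beta> k / 2"
    and \<eta>: "\<And>k. k \<in> {1..N} \<Longrightarrow> \<eta> k = 1 / real N"
    and chi: "\<And>k. k \<in> {1..N} \<Longrightarrow> chi k = 1 / real N"
    and run: "ncgs_run \<Omega> G \<alpha> lam \<beta> \<eta> chi m \<theta>0 N xs x y z g"
  shows "L / 4 * (\<Sum>k=1..N. real k * (real k + 1) / 2 * (norm (y k - z k))\<^sup>2)
    \<le> 2 * L * (norm (\<theta>0 - u))\<^sup>2 + ((real N + 1) * (real N + 2) / 6 + (real N + 1) / 2)
      + l / 2 * (8 * M\<^sup>2 * real N + ((norm u)\<^sup>2 + M\<^sup>2) * (real N * (real N + 1)))
      + (\<Sum>k=1..N. real k * (real k + 1) / 2 * (norm (g k - grad F (z k)))\<^sup>2) / L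
      - (\<Sum>k=1..N. real k * ((x (k - 1) - u) \<bullet> (g k - grad F (z k))))"
proof -
  define a where "a k = real k * (real k + 1) / 2" for k :: nat
  define \<delta> where "\<delta> k = g k - grad F (z k)" for k
  define e where "e k = (a k + real k) / real N
      + l / 2 * (8 * M\<^sup>2 + real k * (2 * ((norm u)\<^sup>2 + M\<^sup>2)))
      + a k * (norm (\<delta> k))\<^sup>2 / L - real k * ((x (k - 1) - u) \<bullet> \<delta> k)" for k
  have \<alpha>_rng: "0 \<le> \<alpha> k \<and> \<alpha> k \<le> 1" if "k \<in> {1..N}" for k
    using that \<alpha>[OF that] by simp
  have pos: "lam k > 0 \<and> \<beta> k > 0 \<and> \<eta> k > 0 \<and> chi k > 0" if "k \<in> {1..N}" for k
    using that L N by (simp add: lam[OF that] \<beta>[OF that] \<eta>[OF that] chi[OF that])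
  have dom: "k \<le> N \<Longrightarrow> x k \<in> \<Omega> \<and> y k \<in> \<Omega>" "k \<in> {1..N} \<Longrightarrow> z k \<in> \<Omega>" for k
    by (intro ncgs_run_in_domain[OF \<Omega> run] \<alpha>_rng pos; assumption)+
  \<comment> \<open>The quantity followed is the weighted function gap plus \<open>2 * L\<close>
    times the squared distance to \<open>u\<close>; an iteration raises it by at most
    \<open>e k\<close> minus the gain.\<close>
  have step: "a k * (F (y k) - F u) + L / 4 * (a k * (norm (y k - z k))\<^sup>2) + 2 * L * (norm (x k - u))\<^sup>2
      \<le> a (k - 1) * (F (y (k - 1)) - F u) + 2 * L * (norm (x (k - 1) - u))\<^sup>2 + e k"
    if k: "k \<in> {1..N}" for k
  proof -
    have k1: "real k \<ge> 1" "real (k - 1) = real k - 1" and km: "k - 1 \<le> N" "k \<le> N" using k by auto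
    have z: "z k = (1 - \<alpha> k) *\<^sub>R y (k - 1) + \<alpha> k *\<^sub>R x (k - 1)"
      and cx: "condg \<Omega> (g k) (x (k - 1)) (lam k) (1 / real N) (x k)"
      and cy: "condg \<Omega> (g k) (z k) (\<beta> k) (1 / real N) (y k)"
      using ncgs_runD(1,3,4)[OF run k] unfolding \<eta>[OF k] chi[OF k] by auto
    have ak: "a k \<ge> 0" by (simp add: a_def)
    have aka: "a k * \<alpha> k = real k"
      using k1 by (simp add: a_def \<alpha>[OF k] divide_simps)
    \<comment> \<open>The weights undo the contraction factor exactly, so the function gaps
      telescope.\<close>
    have ak1: "a k * (1 - \<alpha> k) = a (k - 1)"
      unfolding right_diff_distrib aka using k1 by (simp add: a_def field_simps)
    have step_le: "\<alpha> k * lam k \<le> \<beta> k"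
      using L k1 by (simp add: \<alpha>[OF k] lam[OF k] \<beta>[OF k] divide_simps)
    \<comment> \<open>Here Young's weight is \<open>c = L / 2\<close>: the gain becomes
      \<open>L - L / 2 - L / 4 = L / 4\<close>, and the noise term is the squared error divided by
      \<open>L\<close>.\<close>
    define B where "B = F (y k) - F u + (1 / (2 * \<beta> k) - L / 2 - (L / 2) / 2) * (norm (y k - z k))\<^sup>2"
    define E where "E = (1 - \<alpha> k) * (norm (z k - y (k - 1)))\<^sup>2 + \<alpha> k * (norm (z k - u))\<^sup>2"
    have "B \<le> (1 - \<alpha> k) * (F (y (k - 1)) - F u) + (1 + \<alpha> k) * (1 / real N)
        + \<alpha> k / (2 * lam k) * ((norm (x (k - 1) - u))\<^sup>2 - (norm (x k - u))\<^sup>2)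
        + l / 2 * E + (norm (\<delta> k))\<^sup>2 / (2 * (L / 2)) - \<alpha> k * ((x (k - 1) - u) \<bullet> \<delta> k)"
      unfolding B_def E_def \<delta>_def
      using dom(1)[OF km(1)] dom(1)[OF km(2)] \<alpha>_rng[OF k] pos[OF k] L u(1)
      by (intro ncgs_step_bound[OF \<Omega>(1,2) diff smooth lower _ _ _ _ _ _ _ _ _ _ step_le z cx cy]) auto
    from mult_left_mono[OF this ak]
    have "a k * B \<le> (a k * (1 - \<alpha> k)) * (F (y (k - 1)) - F u) + (a k + a k * \<alpha> k) / real N
        + (a k * \<alpha> k) / (2 * lam k) * ((norm (x (k - 1) - u))\<^sup>2 - (norm (x k - u))\<^sup>2)
        + l / 2 * (a k * E) + a k * (norm (\<delta> k))\<^sup>2 / L - (a k * \<alpha> k) * ((x (k - 1) - u) \<bullet> \<delta> k)"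
      by (simp add: algebra_simps add_divide_distrib diff_divide_distrib)
    moreover have "real k / (2 * lam k) = 2 * L" using L k1 by (simp add: lam[OF k] \<beta>[OF k])
    then have "real k / (2 * lam k) * ((norm (x (k - 1) - u))\<^sup>2 - (norm (x k - u))\<^sup>2)
        = 2 * L * (norm (x (k - 1) - u))\<^sup>2 - 2 * L * (norm (x k - u))\<^sup>2"
      by (simp only: right_diff_distrib)
    moreover have "a k * B = a k * (F (y k) - F u) + L / 4 * (a k * (norm (y k - z k))\<^sup>2)"
      using L by (simp add: B_def \<beta>[OF k] algebra_simps)
    moreover have "l / 2 * (a k * E) \<le> l / 2 * (8 * M\<^sup>2 + real k * (2 * ((norm u)\<^sup>2 + M\<^sup>2)))"
      unfolding E_def a_def
      using l \<alpha>[OF k] z M[OF conjunct1[OF dom(1)[OF km(1)]]] M[OF conjunct2[OF dom(1)[OF km(1)]]]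
        M[OF dom(2)[OF k]]
      by (intro mult_left_mono lower_smooth_error_bound) auto
    ultimately show ?thesis
      unfolding aka ak1 e_def by linarith
  qed
  have "n \<le> N \<Longrightarrow> a n * (F (y n) - F u) + L / 4 * (\<Sum>k=1..n. a k * (norm (y k - z k))\<^sup>2)
      + 2 * L * (norm (x n - u))\<^sup>2 \<le> 2 * L * (norm (\<theta>0 - u))\<^sup>2 + (\<Sum>k=1..n. e k)" for n
  proof (induction n)
    \<comment> \<open>As \<open>a 0 = 0\<close>, the initial function gap drops out and only the
      initial distance remains.\<close>
    case 0
    then show ?case using run by (simp add: a_def ncgs_run_def)
  next
    case (Suc n)
    then show ?case using step[of "Suc n"] by (simp add: distrib_left)
  qed
  from this[OF order_refl] have "L / 4 * (\<Sum>k=1..N. a k * (norm (y k - z k))\<^sup>2)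
      \<le> 2 * L * (norm (\<theta>0 - u))\<^sup>2 + (\<Sum>k=1..N. e k)"
  proof -
    \<comment> \<open>Minimality of \<open>u\<close> enters only here, to discard the final function
      gap.\<close>
    have "0 \<le> a N * (F (y N) - F u)" using u(2) dom(1)[of N] by (simp add: a_def)
    moreover have "0 \<le> 2 * L * (norm (x N - u))\<^sup>2" using L by simp
    ultimately show ?thesis using \<open>a N * (F (y N) - F u) + _ + _ \<le> _\<close> by linarith
  qed
  also have "(\<Sum>k=1..N. e k) = ((real N + 1) * (real N + 2) / 6 + (real N + 1) / 2)
      + l / 2 * (8 * M\<^sup>2 * real N + ((norm u)\<^sup>2 + M\<^sup>2) * (real N * (real N + 1)))
      + (\<Sum>k=1..N. a k * (norm (\<delta> k))\<^sup>2) / L - (\<Sum>k=1..N. real k * ((x (k - 1) - u) \<bullet> \<delta> k))"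
  proof -
    have "(\<Sum>k=1..N. (a k + real k) / real N)
        = (\<Sum>k=1..N. real k * (real k + 1) / 2) / real N + (\<Sum>k=1..N. real k) / real N"
      by (simp add: sum.distrib a_def add_divide_distrib sum_divide_distrib)
    also have "\<dots> = (real N + 1) * (real N + 2) / 6 + (real N + 1) / 2"
      unfolding sum_triangular_real sum_of_nat_real using N by simp
    finally have 1: "(\<Sum>k=1..N. (a k + real k) / real N) = \<dots>" .
    have "(\<Sum>k=1..N. 8 * M\<^sup>2 + real k * (2 * ((norm u)\<^sup>2 + M\<^sup>2)))
        = 8 * M\<^sup>2 * real N + (\<Sum>k=1..N. real k) * (2 * ((norm u)\<^sup>2 + M\<^sup>2))"
      by (simp add: sum.distrib sum_distrib_right)
    also have "\<dots> = 8 * M\<^sup>2 * real N + ((norm u)\<^sup>2 + M\<^sup>2) * (real N * (real N + 1))"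
      unfolding sum_of_nat_real by (simp add: field_simps)
    finally have 2: "(\<Sum>k=1..N. l / 2 * (8 * M\<^sup>2 + real k * (2 * ((norm u)\<^sup>2 + M\<^sup>2)))) = l / 2 * \<dots>"
      by (simp only: sum_distrib_left[symmetric])
    show ?thesis
      unfolding e_def sum.distrib sum_subtractf 1 2 by (simp add: sum_divide_distrib)
  qed
  finally show ?thesis unfolding a_def \<delta>_def by linarith
qed

section \<open>Joint measurability of stochastic gradients\<close>

text \<open>Replace the first argument by simple functions tending to the identity. Such a function
  has finite range, so each approximation is pieced together from finitely many sections
  \<open>f c\<close>; continuity in the first argument gives the pointwise limit.\<close>

lemma borel_measurable_Caratheodory:
  fixes f :: "'a::{metric_space, second_countable_topology} \<Rightarrow> 's \<Rightarrow> 'b::metric_space"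
  assumes meas: "\<And>x. f x \<in> borel_measurable P"
    and cont: "\<And>s x. s \<in> space P \<Longrightarrow> isCont (\<lambda>x. f x s) x"
  shows "(\<lambda>(x, s). f x s) \<in> borel_measurable (borel \<Otimes>\<^sub>M P)"
proof -
  obtain q :: "nat \<Rightarrow> 'a \<Rightarrow> 'a" where q: "\<And>i. simple_function borel (q i)"
    and lim: "\<And>x. (\<lambda>i. q i x) \<longlonglongrightarrow> x"
    using borel_measurable_implies_sequence_metric[of "\<lambda>x::'a. x" borel undefined] by auto
  show ?thesis
  proof (rule borel_measurable_LIMSEQ_metric)
    show "(\<lambda>(x, s). f (q i x) s) \<in> borel_measurable (borel \<Otimes>\<^sub>M P)" for i
      unfolding case_prod_beta
    proof (rule measurable_compose_countable'[where I = "range (q i)"])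
      have "finite (range (q i))" using simple_functionD(1)[OF q[of i]] by simp
      then show "countable (range (q i))" by (rule countable_finite)
      have "q i \<in> measurable borel (count_space (range (q i)))"
        using \<open>finite (range (q i))\<close> simple_functionD(2)[OF q[of i]]
        by (subst measurable_count_space_eq2) auto
      then show "(\<lambda>p. q i (fst p)) \<in> measurable (borel \<Otimes>\<^sub>M P) (count_space (range (q i)))"
        by measurable
    qed (use meas in measurable)
  next
    fix p :: "'a \<times> 's" assume "p \<in> space (borel \<Otimes>\<^sub>M P)"
    then show "(\<lambda>i. case p of (x, s) \<Rightarrow> f (q i x) s) \<longlonglongrightarrow> (case p of (x, s) \<Rightarrow> f x s)"
      using isCont_tendsto_compose[OF cont lim] by (auto simp: space_pair_measure)
  qed
qed

text \<open>Each coordinate is the limit of difference quotients, which are jointly measurable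
  because differentiability makes \<open>f\<close> a Caratheodory function. Joint measurability is
  what allows a gradient to be evaluated at a random point.\<close>

lemma borel_measurable_stoch_grad:
  fixes f :: "'a::euclidean_space \<Rightarrow> 's \<Rightarrow> real"
  assumes meas: "\<And>x. f x \<in> borel_measurable P"
    and diff: "\<And>x s. s \<in> space P \<Longrightarrow> (\<lambda>y. f y s) differentiable (at x)"
  shows "(\<lambda>(x, s). stoch_grad f x s) \<in> borel_measurable (borel \<Otimes>\<^sub>M P)"
proof -
  have f [measurable]: "(\<lambda>(x, s). f x s) \<in> borel_measurable (borel \<Otimes>\<^sub>M P)"
    using diff by (intro borel_measurable_Caratheodory meas differentiable_imp_continuous_within) auto
  show ?thesis
  proof (subst borel_measurable_euclidean_space, intro ballI)
    fix b :: 'a assume "b \<in> Basis"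
    define h where "h n = inverse (real (Suc n))" for n
    have h: "filterlim h (at 0) sequentially"
      using LIMSEQ_inverse_real_of_nat unfolding filterlim_at h_def by simp
    show "(\<lambda>p. (case p of (x, s) \<Rightarrow> stoch_grad f x s) \<bullet> b) \<in> borel_measurable (borel \<Otimes>\<^sub>M P)"
    proof (rule borel_measurable_LIMSEQ_metric)
      fix n
      have "(\<lambda>p. (fst p + h n *\<^sub>R b, snd p)) \<in> measurable (borel \<Otimes>\<^sub>M P) (borel \<Otimes>\<^sub>M P)"
        by measurable
      from measurable_compose[OF this f]
      show "(\<lambda>(x, s). (f (x + h n *\<^sub>R b) s - f x s) / h n) \<in> borel_measurable (borel \<Otimes>\<^sub>M P)"
        using f by (simp add: case_prod_beta)
    next
      fix p :: "'a \<times> 's" assume "p \<in> space (borel \<Otimes>\<^sub>M P)"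
      then obtain x s where p: "p = (x, s)" and s: "s \<in> space P" by (auto simp: space_pair_measure)
      have "((\<lambda>t. f (x + t *\<^sub>R b) s) has_real_derivative stoch_grad f x s \<bullet> b) (at 0)"
        using has_real_derivative_along_line[of "\<lambda>y. f y s" x 0 b] diff[OF s] by (simp add: stoch_grad_def)
      then have "((\<lambda>t. (f (x + t *\<^sub>R b) s - f x s) / t) \<longlongrightarrow> stoch_grad f x s \<bullet> b) (at 0)"
        by (simp add: has_field_derivative_iff)
      from filterlim_compose[OF this h]
      show "(\<lambda>n. case p of (x, s) \<Rightarrow> (f (x + h n *\<^sub>R b) s - f x s) / h n)
          \<longlonglongrightarrow> (case p of (x, s) \<Rightarrow> stoch_grad f x s) \<bullet> b"
        by (simp add: p)
    qed
  qed
qed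

section \<open>Independence of samples and their past\<close>

text \<open>\<open>sample_history\<close> advances by whole iterations. An arbitrary index set
  allows the samples of one batch to be adjoined one at a time.\<close>

definition generated_by :: "'w measure \<Rightarrow> 's measure \<Rightarrow> ('i \<Rightarrow> 'w \<Rightarrow> 's) \<Rightarrow> 'i set \<Rightarrow> 'w measure" where
  "generated_by Q P X J = sigma (space Q) (\<Union>i\<in>J. {X i -` A \<inter> space Q |A. A \<in> sets P})"

lemma sample_history_eq_generated_by:
  fixes Q :: "'w measure"
  shows "sample_history Q P \<xi> m k = generated_by Q P (\<lambda>(k, i). \<xi> k i) (SIGMA j:{1..k}. {1..m j})"
proof -
  have "(\<Union>j\<in>A. \<Union>i\<in>B j. E (j, i)) = (\<Union>p\<in>Sigma A B. E p)"
    for A :: "nat set" and B :: "nat \<Rightarrow> nat set" and E :: "nat \<times> nat \<Rightarrow> 'w set set"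
    by auto
  from this[where E = "\<lambda>p. {(case p of (k, i) \<Rightarrow> \<xi> k i) -` A \<inter> space Q |A. A \<in> sets P}"]
  show ?thesis unfolding sample_history_def generated_by_def by simp
qed

lemma space_generated_by [simp]: "space (generated_by Q P X J) = space Q"
  unfolding generated_by_def by (intro space_measure_of) auto

lemma sets_generated_by:
  "sets (generated_by Q P X J) =
    sigma_sets (space Q) (\<Union>i\<in>J. {X i -` A \<inter> space Q |A. A \<in> sets P})"
  unfolding generated_by_def by (intro sets_measure_of) auto

lemma measurable_generated_by_mono:
  assumes "J \<subseteq> K" "Z \<in> measurable (generated_by Q P X J) S"
  shows "Z \<in> measurable (generated_by Q P X K) S"
proof -
  have "sets (generated_by Q P X J) \<subseteq> sets (generated_by Q P X K)"
    unfolding sets_generated_by using assms(1) by (intro sigma_sets_mono') auto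
  then show ?thesis using assms(2) by (auto simp: measurable_def)
qed

lemma measurable_generated_by_member:
  assumes "i \<in> J" "X i \<in> measurable Q P"
  shows "X i \<in> measurable (generated_by Q P X J) P"
  using assms measurable_space[OF assms(2)]
  by (auto simp: measurable_def sets_generated_by intro!: sigma_sets.Basic)

lemma measurable_from_generated_by:
  assumes "\<And>i. i \<in> J \<Longrightarrow> X i \<in> measurable Q P" "Z \<in> measurable (generated_by Q P X J) S"
  shows "Z \<in> measurable Q S"
proof -
  have "sets (generated_by Q P X J) \<subseteq> sets Q"
    unfolding sets_generated_by
    using assms(1) by (intro sets.sigma_sets_subset) (auto intro: measurable_sets)
  then show ?thesis using assms(2) by (auto simp: measurable_def)
qed

text \<open>The library's \<open>indep_var\<close> forces both variables to have the same type, hence the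
  formulation by product laws.\<close>

lemma (in prob_space) distr_Pair_eq_of_indep_set:
  assumes Z: "Z \<in> measurable M S" and Y: "Y \<in> measurable M T"
    and indep: "indep_set (sigma_sets (space M) {Z -` A \<inter> space M |A. A \<in> sets S})
      (sigma_sets (space M) {Y -` A \<inter> space M |A. A \<in> sets T})"
  shows "distr M (S \<Otimes>\<^sub>M T) (\<lambda>w. (Z w, Y w)) = distr M S Z \<Otimes>\<^sub>M distr M T Y"
proof (rule pair_measure_eqI[symmetric])
  interpret Z: prob_space "distr M S Z" by (rule prob_space_distr[OF Z])
  interpret Y: prob_space "distr M T Y" by (rule prob_space_distr[OF Y])
  show "sigma_finite_measure (distr M S Z)" "sigma_finite_measure (distr M T Y)" ..
  fix A B assume "A \<in> sets (distr M S Z)" "B \<in> sets (distr M T Y)"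
  then have A: "A \<in> sets S" and B: "B \<in> sets T" by auto
  have "prob ((Z -` A \<inter> space M) \<inter> (Y -` B \<inter> space M)) =
      prob (Z -` A \<inter> space M) * prob (Y -` B \<inter> space M)"
    by (rule indep_setD[OF indep]) (use A B in \<open>auto intro!: sigma_sets.Basic\<close>)
  moreover have "(\<lambda>w. (Z w, Y w)) -` (A \<times> B) \<inter> space M = (Z -` A \<inter> space M) \<inter> (Y -` B \<inter> space M)"
    by auto
  ultimately show "emeasure (distr M S Z) A * emeasure (distr M T Y) B
      = emeasure (distr M (S \<Otimes>\<^sub>M T) (\<lambda>w. (Z w, Y w))) (A \<times> B)"
    using A B Z Y by (simp add: emeasure_distr emeasure_eq_measure ennreal_mult)
qed simp

text \<open>The disjoint index blocks \<open>J\<close> and \<open>{i}\<close> of an independent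
  family generate independent sigma-algebras, and \<open>Z\<close> is measurable for the first of
  them.\<close>

lemma (in prob_space) distr_Pair_generated_by:
  assumes indep: "indep_vars (\<lambda>_. P) X I" and J: "J \<subseteq> I" and i: "i \<in> I - J"
    and Z: "Z \<in> measurable (generated_by M P X J) S"
  shows "distr M (S \<Otimes>\<^sub>M P) (\<lambda>w. (Z w, X i w)) = distr M S Z \<Otimes>\<^sub>M distr M P (X i)"
proof -
  define E where "E i = {X i -` A \<inter> space M |A. A \<in> sets P}" for i
  have X: "X j \<in> measurable M P" if "j \<in> I" for j using indep that by (auto simp: indep_vars_def2)
  have E: "indep_sets E I" using indep unfolding indep_vars_def2 E_def by simp
  have "indep_sets (\<lambda>b. sigma_sets (space M) (\<Union>i\<in>case_bool J {i} b. E i)) UNIV"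
  proof (rule indep_sets_collect_sigma)
    show "indep_sets E (\<Union>b\<in>UNIV. case_bool J {i} b)"
      by (rule indep_sets_mono_index[OF _ E]) (use J i in \<open>auto split: bool.splits\<close>)
    show "Int_stable (E j)" for j
      unfolding E_def Int_stable_def
    proof safe
      fix A B assume "A \<in> sets P" "B \<in> sets P"
      then show "\<exists>C. X j -` A \<inter> space M \<inter> (X j -` B \<inter> space M) = X j -` C \<inter> space M \<and> C \<in> sets P"
        by (intro exI[of _ "A \<inter> B"]) auto
    qed
    show "disjoint_family_on (case_bool J {i}) UNIV"
      using i by (auto simp: disjoint_family_on_def split: bool.splits)
  qed
  then have "indep_set (sigma_sets (space M) {Z -` A \<inter> space M |A. A \<in> sets S})
      (sigma_sets (space M) {X i -` A \<inter> space M |A. A \<in> sets P})"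
    unfolding indep_set_def
  proof (rule indep_sets_mono_sets)
    fix b :: bool
    have "sigma_sets (space M) {Z -` A \<inter> space M |A. A \<in> sets S}
        \<subseteq> sigma_sets (space M) (\<Union>i\<in>J. E i)"
      using measurable_sets[OF Z] by (intro sigma_sets_mono) (auto simp: sets_generated_by E_def)
    then show "(case b of True \<Rightarrow> sigma_sets (space M) {Z -` A \<inter> space M |A. A \<in> sets S}
        | False \<Rightarrow> sigma_sets (space M) {X i -` A \<inter> space M |A. A \<in> sets P})
        \<subseteq> sigma_sets (space M) (\<Union>i\<in>case_bool J {i} b. E i)"
      by (cases b) (auto simp: E_def)
  qed
  moreover have "Z \<in> measurable M S"
    by (rule measurable_from_generated_by[OF X Z]) (use J in auto)
  ultimately show ?thesis using X i by (intro distr_Pair_eq_of_indep_set) auto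
qed

section \<open>Centred noise independent of the past\<close>

text \<open>Under the product law \<open>z\<close> can be frozen and the sample integrated first,
  where the bound \<open>c\<close> holds for every \<open>z\<close>. Tonelli's theorem needs no
  prior integrability, so integrability comes out of the same estimate.\<close>

lemma (in prob_space) indep_noise_second_moment:
  fixes D :: "'z \<Rightarrow> 's \<Rightarrow> 'b::euclidean_space"
  assumes rv [measurable]: "Z \<in> measurable M S" "Y \<in> measurable M P"
    and joint: "distr M (S \<Otimes>\<^sub>M P) (\<lambda>w. (Z w, Y w)) = distr M S Z \<Otimes>\<^sub>M P"
    and distr: "distr M P Y = P"
    and D: "(\<lambda>(z, s). D z s) \<in> borel_measurable (S \<Otimes>\<^sub>M P)"
    and int: "\<And>z. z \<in> space S \<Longrightarrow> integrable P (\<lambda>s. (norm (D z s))\<^sup>2)"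
    and le: "\<And>z. z \<in> space S \<Longrightarrow> (\<integral>s. (norm (D z s))\<^sup>2 \<partial>P) \<le> c" and c: "c \<ge> 0"
  shows "integrable M (\<lambda>w. (norm (D (Z w) (Y w)))\<^sup>2)"
    and "expectation (\<lambda>w. (norm (D (Z w) (Y w)))\<^sup>2) \<le> c"
proof -
  note D [measurable]
  interpret P: prob_space P using prob_space_distr[OF rv(2)] by (simp add: distr)
  interpret S: prob_space "distr M S Z" by (rule prob_space_distr[OF rv(1)])
  define q where "q = (\<lambda>p. (norm (case p of (z, s) \<Rightarrow> D z s))\<^sup>2)"
  have q [measurable]: "q \<in> borel_measurable (S \<Otimes>\<^sub>M P)" unfolding q_def by measurable
  have "(\<integral>\<^sup>+w. ennreal (q (Z w, Y w)) \<partial>M) = (\<integral>\<^sup>+p. ennreal (q p) \<partial>(distr M S Z \<Otimes>\<^sub>M P))"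
    unfolding joint[symmetric] by (subst nn_integral_distr) auto
  also have "\<dots> = (\<integral>\<^sup>+z. \<integral>\<^sup>+s. ennreal (q (z, s)) \<partial>P \<partial>distr M S Z)"
    by (intro P.nn_integral_fst[symmetric]) (simp add: measurable_distr_eq1)
  also have "\<dots> \<le> (\<integral>\<^sup>+z. ennreal c \<partial>distr M S Z)"
  proof (rule nn_integral_mono)
    fix z assume "z \<in> space (distr M S Z)"
    then have z: "z \<in> space S" by simp
    then show "(\<integral>\<^sup>+s. ennreal (q (z, s)) \<partial>P) \<le> ennreal c"
      using nn_integral_eq_integral[OF int[OF z]] le[OF z] by (simp add: q_def ennreal_leI)
  qed
  also have "\<dots> = ennreal c" using S.emeasure_space_1 by simp
  finally have bound: "(\<integral>\<^sup>+w. ennreal (q (Z w, Y w)) \<partial>M) \<le> ennreal c" .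
  have "integrable M (\<lambda>w. q (Z w, Y w))"
  proof (rule integrableI_nonneg)
    show "(\<integral>\<^sup>+w. ennreal (q (Z w, Y w)) \<partial>M) < \<infinity>"
      using bound by (rule le_less_trans) simp
  qed (auto simp: q_def)
  then show int: "integrable M (\<lambda>w. (norm (D (Z w) (Y w)))\<^sup>2)" by (simp add: q_def)
  show "expectation (\<lambda>w. (norm (D (Z w) (Y w)))\<^sup>2) \<le> c"
    using bound nn_integral_eq_integral[OF int] c by (simp add: q_def)
qed

lemma (in prob_space) integrable_inner_square:
  fixes V W :: "'a \<Rightarrow> 'b::euclidean_space"
  assumes "V \<in> borel_measurable M" "W \<in> borel_measurable M"
    and "integrable M (\<lambda>w. (norm (V w))\<^sup>2)" "integrable M (\<lambda>w. (norm (W w))\<^sup>2)"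
  shows "integrable M (\<lambda>w. V w \<bullet> W w)"
proof (rule Bochner_Integration.integrable_bound)
  show "integrable M (\<lambda>w. (norm (V w))\<^sup>2 + (norm (W w))\<^sup>2)" using assms by simp
  show "(\<lambda>w. V w \<bullet> W w) \<in> borel_measurable M" using assms(1,2) by measurable
  have "\<bar>v \<bullet> x\<bar> \<le> (norm v)\<^sup>2 + (norm x)\<^sup>2" for v x :: 'b
  proof -
    have "2 * (norm v * norm x) \<le> (norm v)\<^sup>2 + (norm x)\<^sup>2"
      using sum_squares_bound[of "norm v" "norm x"] by simp
    moreover have "0 \<le> norm v * norm x" by simp
    ultimately show ?thesis using Cauchy_Schwarz_ineq2[of v x] by linarith
  qed
  then show "AE w in M. norm (V w \<bullet> W w) \<le> norm ((norm (V w))\<^sup>2 + (norm (W w))\<^sup>2)" by simp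
qed

text \<open>For frozen \<open>z\<close> the factor \<open>V z\<close> is constant and
  \<open>D z\<close> is centred, so the inner integral is zero. Fubini's theorem does need
  integrability here, and square integrability of both factors provides it.\<close>

lemma (in prob_space) indep_noise_inner:
  fixes D :: "'z \<Rightarrow> 's \<Rightarrow> 'b::euclidean_space"
  assumes rv [measurable]: "Z \<in> measurable M S" "Y \<in> measurable M P"
    and joint: "distr M (S \<Otimes>\<^sub>M P) (\<lambda>w. (Z w, Y w)) = distr M S Z \<Otimes>\<^sub>M P"
    and distr: "distr M P Y = P"
    and D: "(\<lambda>(z, s). D z s) \<in> borel_measurable (S \<Otimes>\<^sub>M P)"
    and mean: "\<And>z. z \<in> space S \<Longrightarrow> integrable P (D z) \<and> (\<integral>s. D z s \<partial>P) = 0"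
    and D2: "integrable M (\<lambda>w. (norm (D (Z w) (Y w)))\<^sup>2)"
    and V: "V \<in> borel_measurable S" and V2: "integrable M (\<lambda>w. (norm (V (Z w)))\<^sup>2)"
  shows "integrable M (\<lambda>w. V (Z w) \<bullet> D (Z w) (Y w))"
    and "expectation (\<lambda>w. V (Z w) \<bullet> D (Z w) (Y w)) = 0"
proof -
  note D [measurable] V [measurable]
  interpret P: prob_space P using prob_space_distr[OF rv(2)] by (simp add: distr)
  interpret S: prob_space "distr M S Z" by (rule prob_space_distr[OF rv(1)])
  interpret SP: pair_prob_space "distr M S Z" P ..
  have DZY: "(\<lambda>w. D (Z w) (Y w)) \<in> borel_measurable M"
    using measurable_compose[OF measurable_Pair[OF rv] D] by simp
  show int: "integrable M (\<lambda>w. V (Z w) \<bullet> D (Z w) (Y w))"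
    by (rule integrable_inner_square[OF _ DZY V2 D2]) simp
  define q where "q = (\<lambda>p. V (fst p) \<bullet> (case p of (z, s) \<Rightarrow> D z s))"
  have q [measurable]: "q \<in> borel_measurable (S \<Otimes>\<^sub>M P)" unfolding q_def by measurable
  have "integrable (distr M S Z \<Otimes>\<^sub>M P) q"
    unfolding joint[symmetric] by (subst integrable_distr_eq) (use int in \<open>auto simp: q_def\<close>)
  then have "integral\<^sup>L (distr M S Z \<Otimes>\<^sub>M P) q = (\<integral>z. \<integral>s. q (z, s) \<partial>P \<partial>distr M S Z)"
    by (rule SP.integral_fst'[symmetric])
  also have "\<dots> = (\<integral>z. 0 \<partial>distr M S Z)"
    using mean by (intro Bochner_Integration.integral_cong) (auto simp: q_def)
  finally have "integral\<^sup>L (distr M S Z \<Otimes>\<^sub>M P) q = 0" by simp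
  moreover have "expectation (\<lambda>w. V (Z w) \<bullet> D (Z w) (Y w)) = integral\<^sup>L (distr M S Z \<Otimes>\<^sub>M P) q"
    unfolding joint[symmetric] by (subst integral_distr) (auto simp: q_def)
  ultimately show "expectation (\<lambda>w. V (Z w) \<bullet> D (Z w) (Y w)) = 0" by simp
qed

text \<open>The summands are orthogonal: the sample added last is independent of the past and of the
  partial sum, so the cross term has mean zero. The bound is therefore linear in the batch
  size.\<close>

lemma (in prob_space) batch_noise_second_moment:
  fixes D :: "'z \<Rightarrow> 's \<Rightarrow> 'b::euclidean_space" and X :: "'i \<Rightarrow> 'a \<Rightarrow> 's"
  assumes indep: "indep_vars (\<lambda>_. P) X I" and distr: "\<And>i. i \<in> I \<Longrightarrow> distr M P (X i) = P"
    and J: "J \<subseteq> I" and Z: "Z \<in> measurable (generated_by M P X J) S"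
    and D: "(\<lambda>(z, s). D z s) \<in> borel_measurable (S \<Otimes>\<^sub>M P)"
    and mean: "\<And>z. z \<in> space S \<Longrightarrow> integrable P (D z) \<and> (\<integral>s. D z s \<partial>P) = 0"
    and int: "\<And>z. z \<in> space S \<Longrightarrow> integrable P (\<lambda>s. (norm (D z s))\<^sup>2)"
    and le: "\<And>z. z \<in> space S \<Longrightarrow> (\<integral>s. (norm (D z s))\<^sup>2 \<partial>P) \<le> c" and c: "c \<ge> 0"
    and K: "finite K" "K \<subseteq> I - J"
  shows "integrable M (\<lambda>w. (norm (\<Sum>i\<in>K. D (Z w) (X i w)))\<^sup>2) \<and>
    expectation (\<lambda>w. (norm (\<Sum>i\<in>K. D (Z w) (X i w)))\<^sup>2) \<le> real (card K) * c"
  using K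
proof (induction K)
  case empty
  then show ?case by simp
next
  case (insert i K)
  define W where "W w = (\<Sum>j\<in>K. D (Z w) (X j w))" for w
  define Z' where "Z' w = (Z w, W w)" for w
  define D' where "D' p s = D (fst p) s" for p :: "'z \<times> 'b" and s
  have X: "X j \<in> measurable M P" if "j \<in> I" for j using indep that by (auto simp: indep_vars_def2)
  have i: "i \<in> I" using insert by auto
  have ZK: "Z \<in> measurable (generated_by M P X (J \<union> K)) S"
    by (rule measurable_generated_by_mono[OF _ Z]) auto
  have "W \<in> borel_measurable (generated_by M P X (J \<union> K))"
    unfolding W_def
  proof (rule borel_measurable_sum)
    fix j assume "j \<in> K"
    then have "X j \<in> measurable (generated_by M P X (J \<union> K)) P"
      using insert.prems X by (intro measurable_generated_by_member) auto
    from measurable_compose[OF measurable_Pair[OF ZK this] D]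
    show "(\<lambda>w. D (Z w) (X j w)) \<in> borel_measurable (generated_by M P X (J \<union> K))" by simp
  qed
  then have Z': "Z' \<in> measurable (generated_by M P X (J \<union> K)) (S \<Otimes>\<^sub>M borel)"
    unfolding Z'_def using ZK by (intro measurable_Pair) auto
  have Z'M: "Z' \<in> measurable M (S \<Otimes>\<^sub>M borel)"
    using X J insert.prems by (intro measurable_from_generated_by[OF _ Z']) auto
  have joint: "distr M ((S \<Otimes>\<^sub>M borel) \<Otimes>\<^sub>M P) (\<lambda>w. (Z' w, X i w)) = distr M (S \<Otimes>\<^sub>M borel) Z' \<Otimes>\<^sub>M P"
    using distr_Pair_generated_by[OF indep _ _ Z', of i] J insert.prems insert.hyps distr[OF i] by auto
  have D': "(\<lambda>(p, s). D' p s) \<in> borel_measurable ((S \<Otimes>\<^sub>M borel) \<Otimes>\<^sub>M P)"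
  proof -
    have "(\<lambda>q. (fst (fst q), snd q)) \<in> measurable ((S \<Otimes>\<^sub>M (borel :: 'b measure)) \<Otimes>\<^sub>M P) (S \<Otimes>\<^sub>M P)"
      by measurable
    from measurable_compose[OF this D] show ?thesis by (simp add: D'_def case_prod_beta)
  qed
  have sp: "fst p \<in> space S" if "p \<in> space (S \<Otimes>\<^sub>M borel)" for p :: "'z \<times> 'b"
    using that by (auto simp: space_pair_measure)
  have IH: "integrable M (\<lambda>w. (norm (W w))\<^sup>2)" "expectation (\<lambda>w. (norm (W w))\<^sup>2) \<le> real (card K) * c"
    using insert unfolding W_def by auto
  have m2: "integrable M (\<lambda>w. (norm (D' (Z' w) (X i w)))\<^sup>2)"
    "expectation (\<lambda>w. (norm (D' (Z' w) (X i w)))\<^sup>2) \<le> c"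
    using indep_noise_second_moment[OF Z'M X[OF i] joint distr[OF i] D' _ _ c] int le sp
    by (simp_all add: D'_def)
  have inner: "integrable M (\<lambda>w. snd (Z' w) \<bullet> D' (Z' w) (X i w))"
    "expectation (\<lambda>w. snd (Z' w) \<bullet> D' (Z' w) (X i w)) = 0"
    using indep_noise_inner[OF Z'M X[OF i] joint distr[OF i] D' _ m2(1), of snd] mean sp IH(1)
    by (simp_all add: D'_def Z'_def)
  have eq: "(\<lambda>w. (norm (\<Sum>j\<in>insert i K. D (Z w) (X j w)))\<^sup>2) = (\<lambda>w. (norm (D' (Z' w) (X i w)))\<^sup>2
      + 2 * (snd (Z' w) \<bullet> D' (Z' w) (X i w)) + (norm (W w))\<^sup>2)"
  proof
    fix w
    have "(\<Sum>j\<in>insert i K. D (Z w) (X j w)) = D' (Z' w) (X i w) + W w"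
      using insert.hyps by (simp add: W_def D'_def Z'_def)
    then show "(norm (\<Sum>j\<in>insert i K. D (Z w) (X j w)))\<^sup>2 = (norm (D' (Z' w) (X i w)))\<^sup>2
      + 2 * (snd (Z' w) \<bullet> D' (Z' w) (X i w)) + (norm (W w))\<^sup>2"
      unfolding power2_norm_eq_inner by (simp add: Z'_def inner_add_left inner_add_right inner_commute)
  qed
  show ?case
    unfolding eq using m2 inner IH insert.hyps by (simp add: distrib_right)
qed

text \<open>Term by term: each sample in \<open>K\<close> lies outside \<open>J\<close> and is thus
  independent of \<open>Z\<close>.\<close>

lemma (in prob_space) batch_noise_inner:
  fixes D :: "'z \<Rightarrow> 's \<Rightarrow> 'b::euclidean_space" and X :: "'i \<Rightarrow> 'a \<Rightarrow> 's"
  assumes indep: "indep_vars (\<lambda>_. P) X I" and distr: "\<And>i. i \<in> I \<Longrightarrow> distr M P (X i) = P"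
    and J: "J \<subseteq> I" and Z: "Z \<in> measurable (generated_by M P X J) S"
    and D: "(\<lambda>(z, s). D z s) \<in> borel_measurable (S \<Otimes>\<^sub>M P)"
    and mean: "\<And>z. z \<in> space S \<Longrightarrow> integrable P (D z) \<and> (\<integral>s. D z s \<partial>P) = 0"
    and int: "\<And>z. z \<in> space S \<Longrightarrow> integrable P (\<lambda>s. (norm (D z s))\<^sup>2)"
    and le: "\<And>z. z \<in> space S \<Longrightarrow> (\<integral>s. (norm (D z s))\<^sup>2 \<partial>P) \<le> c" and c: "c \<ge> 0"
    and K: "K \<subseteq> I - J"
    and V: "V \<in> borel_measurable S" and V2: "integrable M (\<lambda>w. (norm (V (Z w)))\<^sup>2)"
  shows "integrable M (\<lambda>w. V (Z w) \<bullet> (\<Sum>i\<in>K. D (Z w) (X i w)))"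
    and "expectation (\<lambda>w. V (Z w) \<bullet> (\<Sum>i\<in>K. D (Z w) (X i w))) = 0"
proof -
  have X: "X j \<in> measurable M P" if "j \<in> I" for j using indep that by (auto simp: indep_vars_def2)
  have ZM: "Z \<in> measurable M S"
    using X J by (intro measurable_from_generated_by[OF _ Z]) auto
  have *: "integrable M (\<lambda>w. V (Z w) \<bullet> D (Z w) (X i w)) \<and>
      expectation (\<lambda>w. V (Z w) \<bullet> D (Z w) (X i w)) = 0" if "i \<in> K" for i
  proof -
    have i: "i \<in> I - J" "i \<in> I" using that K by auto
    have joint: "distr M (S \<Otimes>\<^sub>M P) (\<lambda>w. (Z w, X i w)) = distr M S Z \<Otimes>\<^sub>M P"
      using distr_Pair_generated_by[OF indep J i(1) Z] distr[OF i(2)] by simp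
    note m2 = indep_noise_second_moment(1)[OF ZM X[OF i(2)] joint distr[OF i(2)] D int le c]
    show ?thesis
      using indep_noise_inner[OF ZM X[OF i(2)] joint distr[OF i(2)] D mean m2 V V2] by simp
  qed
  show "integrable M (\<lambda>w. V (Z w) \<bullet> (\<Sum>i\<in>K. D (Z w) (X i w)))"
    unfolding inner_sum_right using * by (intro Bochner_Integration.integrable_sum) auto
  show "expectation (\<lambda>w. V (Z w) \<bullet> (\<Sum>i\<in>K. D (Z w) (X i w))) = 0"
    unfolding inner_sum_right using * by (subst Bochner_Integration.integral_sum) auto
qed

section \<open>The random iteration count\<close>

text \<open>Write \<open>h (R w) w\<close> as a sum over \<open>k\<close> of the indicator of
  \<open>R = k\<close> times \<open>h k\<close>. The first factor depends on \<open>R\<close> only,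
  the second on \<open>H\<close> only, so each expectation factorises.\<close>

lemma (in prob_space) expectation_random_index:
  fixes h :: "'i \<Rightarrow> 'a \<Rightarrow> real"
  assumes indep: "indep_set {R -` A \<inter> space M |A. A \<in> UNIV} (sets H)" and H: "space H = space M"
    and R: "\<And>w. w \<in> space M \<Longrightarrow> R w \<in> K" and K: "finite K"
    and h: "\<And>k. k \<in> K \<Longrightarrow> h k \<in> borel_measurable H" "\<And>k. k \<in> K \<Longrightarrow> integrable M (h k)"
  shows "integrable M (\<lambda>w. h (R w) w)"
    and "expectation (\<lambda>w. h (R w) w) = (\<Sum>k\<in>K. prob {w \<in> space M. R w = k} * expectation (h k))"
proof -
  define e where "e k w = (indicator {w \<in> space M. R w = k} w :: real)" for k w
  have sub: "{R -` A \<inter> space M |A. A \<in> UNIV} \<subseteq> events" using indep by (rule indep_setD_ev1)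
  have Rk: "{w \<in> space M. R w = k} \<in> events" for k
  proof -
    have "{w \<in> space M. R w = k} = R -` {k} \<inter> space M" by auto
    then show ?thesis using sub by blast
  qed
  \<comment> \<open>The sigma-algebra of \<open>R\<close> packaged as a measure space, so that the
    events of an indicator measurable in it lie in the family assumed independent of
    \<open>H\<close>.\<close>
  define HR where "HR = vimage_algebra (space M) R (count_space UNIV)"
  have HR: "sets HR = {R -` A \<inter> space M |A. A \<in> UNIV}" "space HR = space M"
    by (auto simp: HR_def sets_vimage_algebra2)
  have ind: "indep_var borel (e k) borel (h k)" if "k \<in> K" for k
  proof -
    have "{w \<in> space M. R w = k} \<in> sets HR"
      unfolding HR by (auto intro!: exI[of _ "{k}"])
    then have e: "e k \<in> borel_measurable HR"
      unfolding e_def by (intro borel_measurable_indicator)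
    have "sigma_sets (space M) {e k -` A \<inter> space M |A. A \<in> sets borel} \<subseteq> sets HR"
      unfolding HR(2)[symmetric] using measurable_sets[OF e] by (intro sets.sigma_sets_subset) auto
    moreover have "sigma_sets (space M) {h k -` A \<inter> space M |A. A \<in> sets borel} \<subseteq> sets H"
      unfolding H[symmetric] using measurable_sets[OF h(1)[OF that]] by (intro sets.sigma_sets_subset) auto
    ultimately have "indep_set (sigma_sets (space M) {e k -` A \<inter> space M |A. A \<in> sets borel})
        (sigma_sets (space M) {h k -` A \<inter> space M |A. A \<in> sets borel})"
      using indep unfolding HR(1)[symmetric] indep_sets2_eq by blast
    moreover have "e k \<in> borel_measurable M"
      unfolding e_def using Rk by (intro borel_measurable_indicator)
    ultimately show ?thesis
      using h(2)[OF that] by (simp add: indep_var_eq borel_measurable_integrable)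
  qed
  have e_int: "integrable M (e k)" for k
    unfolding e_def using Rk emeasure_finite by (intro integrable_real_indicator) (auto simp: less_top[symmetric])
  have prod_int: "integrable M (\<lambda>w. e k w * h k w)" if "k \<in> K" for k
    by (rule indep_var_integrable[OF ind[OF that] e_int h(2)[OF that]])
  have eq: "h (R w) w = (\<Sum>k\<in>K. e k w * h k w)" if "w \<in> space M" for w
  proof -
    have "(\<Sum>k\<in>K. e k w * h k w) = (\<Sum>k\<in>K. if k = R w then h (R w) w else 0)"
      using that by (intro sum.cong) (auto simp: e_def)
    then show ?thesis using R[OF that] K by simp
  qed
  show "integrable M (\<lambda>w. h (R w) w)"
    using prod_int by (subst Bochner_Integration.integrable_cong[OF refl eq]) auto
  have "expectation (\<lambda>w. h (R w) w) = (\<Sum>k\<in>K. expectation (\<lambda>w. e k w * h k w))"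
    using prod_int by (subst Bochner_Integration.integral_cong[OF refl eq]) auto
  also have "\<dots> = (\<Sum>k\<in>K. expectation (e k) * expectation (h k))"
    by (intro sum.cong refl indep_var_lebesgue_integral ind e_int h(2))
  also have "\<dots> = (\<Sum>k\<in>K. prob {w \<in> space M. R w = k} * expectation (h k))"
  proof (intro sum.cong refl)
    fix k
    have "expectation (e k) = prob {w \<in> space M. R w = k}"
      unfolding e_def using Rk sets.sets_into_space by (subst Bochner_Integration.integral_indicator) (auto simp: Int_absorb2)
    then show "expectation (e k) * expectation (h k) = prob {w \<in> space M. R w = k} * expectation (h k)"
      by simp
  qed
  finally show "expectation (\<lambda>w. h (R w) w) = (\<Sum>k\<in>K. prob {w \<in> space M. R w = k} * expectation (h k))" .
qed

section \<open>The convergence rate\<close>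

text \<open>Projection onto a closed convex set is continuous, which makes the proximal point
  measurable in its data.\<close>

lemma borel_measurable_grad_mapping:
  fixes \<Omega> :: "'a::euclidean_space set"
  assumes "closed \<Omega>" "convex \<Omega>" "\<Omega> \<noteq> {}" "\<gamma> > 0"
    and [measurable]: "z \<in> borel_measurable H" "g \<in> borel_measurable H"
  shows "(\<lambda>w. grad_mapping \<Omega> (z w) (g w) \<gamma>) \<in> borel_measurable H"
proof -
  have [measurable]: "closest_point \<Omega> \<in> borel_measurable borel"
    using assms by (intro borel_measurable_continuous_onI continuous_on_closest_point)
  show ?thesis
    unfolding grad_mapping_def prox_pt_eq_closest_point[OF assms(1-4)] by measurable
qed

lemma sum_succ_half_real: "(\<Sum>k=1..N. (real k + 1) / 2) = real N * (real N + 3) / 4"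
  by (induction N) (auto simp: field_simps)

text \<open>Here \<open>s / 6\<close> is the total weight. Factoring \<open>192 * L\<close> out of
  the left side leaves \<open>L / 4 * T / s + 1 / (48 * n)\<close>, which explains the constant: the
  four groups of the bound on \<open>T\<close>, divided by \<open>s\<close>, go to the four terms on
  the right, and \<open>1 / (48 * n)\<close> fits under \<open>1 / n\<close> along with the
  tolerance terms.\<close>

lemma ncgs_rate:
  fixes T L D l U M2 v n :: real
  assumes n: "n \<ge> 1" and L: "L > 0" and nonneg: "D \<ge> 0" "l \<ge> 0" "U \<ge> 0" "M2 \<ge> 0" "v \<ge> 0"
    and T: "L / 4 * T \<le> 2 * L * D + ((n + 1) * (n + 2) / 6 + (n + 1) / 2)
      + l / 2 * (8 * M2 * n + (U + M2) * (n * (n + 1))) + v * (n * (n + 3) / 4) / L"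
  shows "8 * L\<^sup>2 * (T / (n * (n + 1) * (n + 2) / 6)) + 4 * L / n
    \<le> 192 * L * (4 * L * D / (n\<^sup>2 * (n + 1)) + l / n * (U + 2 * M2) + 1 / n + 3 * v / (2 * L * n))"
proof -
  define s where "s = n * (n + 1) * (n + 2)"
  have s: "s > 0" using n by (simp add: s_def)
  have 1: "2 * L * D / s \<le> 4 * L * D / (n\<^sup>2 * (n + 1))"
  proof -
    have "1 / s \<le> 2 / (n\<^sup>2 * (n + 1))"
      using n by (simp add: s_def divide_simps power2_eq_square)
    from mult_left_mono[OF this, of "2 * L * D"] show ?thesis using L nonneg by simp
  qed
  have 2: "((n + 1) * (n + 2) / 6 + (n + 1) / 2) / s + 1 / (48 * n) \<le> 1 / n"
  proof -
    have "(n + 1) * (n + 2) / 6 / s = 1 / 6 / n" "(n + 1) / 2 / s = 1 / (2 * (n + 2)) / n"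
      using n by (simp_all add: s_def divide_simps)
    then have "((n + 1) * (n + 2) / 6 + (n + 1) / 2) / s = (1 / 6 + 1 / (2 * (n + 2))) / n"
      by (simp only: add_divide_distrib)
    also have "\<dots> + 1 / (48 * n) = (1 / 6 + 1 / (2 * (n + 2)) + 1 / 48) / n"
      by (simp add: add_divide_distrib)
    also have "\<dots> \<le> 1 / n"
    proof (rule divide_right_mono)
      have "1 / (2 * (n + 2)) \<le> 1 / 2" using n by (simp add: divide_simps)
      then show "1 / 6 + 1 / (2 * (n + 2)) + 1 / 48 \<le> 1" by simp
    qed (use n in simp)
    finally show ?thesis .
  qed
  have 3: "l / 2 * (8 * M2 * n + (U + M2) * (n * (n + 1))) / s \<le> l / n * (U + 2 * M2)"
  proof -
    \<comment> \<open>The multiples 3 and 1 of \<open>M2\<close> add up to the 4 in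
      \<open>2 * (U + 2 * M2)\<close>.\<close>
    have "8 * M2 * n \<le> 3 * M2 * ((n + 1) * (n + 2))"
    proof -
      have "8 * n \<le> 3 * ((n + 1) * (n + 2))"
        using n zero_le_power2[of n] by (simp add: algebra_simps power2_eq_square)
      from mult_left_mono[OF this nonneg(4)] show ?thesis by (simp add: mult_ac)
    qed
    moreover have "(U + M2) * (n * (n + 1)) \<le> (U + M2) * ((n + 1) * (n + 2))"
      using n nonneg by (intro mult_left_mono) (auto simp: algebra_simps)
    moreover have "0 \<le> U * ((n + 1) * (n + 2))" using n nonneg by simp
    ultimately have "8 * M2 * n + (U + M2) * (n * (n + 1)) \<le> 2 * (U + 2 * M2) * ((n + 1) * (n + 2))"
      by (simp add: distrib_right)
    then have "l / 2 * (8 * M2 * n + (U + M2) * (n * (n + 1)))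
        \<le> l / 2 * (2 * (U + 2 * M2) * ((n + 1) * (n + 2)))"
      using nonneg by (intro mult_left_mono) auto
    then have "l / 2 * (8 * M2 * n + (U + M2) * (n * (n + 1))) / s
        \<le> l / 2 * (2 * (U + 2 * M2) * ((n + 1) * (n + 2))) / s"
      using s by (intro divide_right_mono) auto
    also have "\<dots> = l * (U + 2 * M2) * (((n + 1) * (n + 2)) / s)"
      using s by (simp add: field_simps)
    also have "((n + 1) * (n + 2)) / s = 1 / n" using n by (simp add: s_def divide_simps)
    also have "l * (U + 2 * M2) * (1 / n) = l / n * (U + 2 * M2)" by simp
    finally show ?thesis .
  qed
  have 4: "v * (n * (n + 3) / 4) / L / s \<le> 3 * v / (2 * L * n)"
  proof -
    have "n * (n + 3) / 4 / s \<le> 3 / (2 * n)"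
      using n by (simp add: s_def divide_simps) (simp add: algebra_simps)
    from mult_left_mono[OF this, of "v / L"] show ?thesis using nonneg L by simp
  qed
  have "L / 4 * T / s \<le> (2 * L * D + ((n + 1) * (n + 2) / 6 + (n + 1) / 2)
      + l / 2 * (8 * M2 * n + (U + M2) * (n * (n + 1))) + v * (n * (n + 3) / 4) / L) / s"
    using T s by (intro divide_right_mono) auto
  then have "L / 4 * T / s + 1 / (48 * n) \<le> 4 * L * D / (n\<^sup>2 * (n + 1)) + l / n * (U + 2 * M2) + 1 / n
      + 3 * v / (2 * L * n)"
    using 1 2 3 4 by (simp only: add_divide_distrib)
  then have "192 * L * (L / 4 * T / s + 1 / (48 * n))
      \<le> 192 * L * (4 * L * D / (n\<^sup>2 * (n + 1)) + l / n * (U + 2 * M2) + 1 / n + 3 * v / (2 * L * n))"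
    using L by (intro mult_left_mono) auto
  moreover have "192 * L * (L / 4 * T / s + 1 / (48 * n)) = 8 * L\<^sup>2 * (T / (s / 6)) + 4 * L / n"
    by (simp add: distrib_left power2_eq_square)
  ultimately show ?thesis by (simp only: s_def)
qed

theorem theorem2:
  fixes \<Omega> :: "'a::euclidean_space set"
    and F :: "'a \<Rightarrow> real" and f :: "'a \<Rightarrow> 's \<Rightarrow> real"
    and P :: "'s measure" and Q :: "'w measure"
    and \<xi> :: "nat \<Rightarrow> nat \<Rightarrow> 'w \<Rightarrow> 's" and R :: "'w \<Rightarrow> nat"
    and \<theta> \<theta>ag \<theta>md Gbar :: "nat \<Rightarrow> 'w \<Rightarrow> 'a"
    and \<theta>0 \<theta>star :: 'a
    and L l \<sigma> M :: real and N :: nat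
    and \<alpha> \<beta> lam \<eta> chi \<Gamma> p :: "nat \<Rightarrow> real" and m :: "nat \<Rightarrow> nat"
  assumes Omega: "\<Omega> \<noteq> {}" "compact \<Omega>" "convex \<Omega>"
    and L_pos: "L > 0" and l_nonneg: "l \<ge> 0" and N_pos: "N \<ge> 1"
    \<comment> \<open>objective and stochastic gradients\<close>
    and P_prob: "prob_space P"
    and f_integrable: "\<And>x. integrable P (f x)"
    and F_eq: "\<And>x. F x = (\<integral>s. f x s \<partial>P)"
    and F_diff: "\<And>x. F differentiable (at x)"
    and f_diff: "\<And>x s. s \<in> space P \<Longrightarrow> (\<lambda>y. f y s) differentiable (at x)"
    and F_smooth: "smooth_on L F \<Omega>"
    and F_lower: "lower_smooth_on l F \<Omega>"
    and G_integrable: "\<And>x. integrable P (stoch_grad f x)"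
    and G_unbiased: "\<And>x. (\<integral>s. stoch_grad f x s \<partial>P) = grad F x"
    and G_var_integrable: "\<And>x. integrable P (\<lambda>s. (norm (stoch_grad f x s - grad F x))\<^sup>2)"
    and G_variance: "\<And>x. (\<integral>s. (norm (stoch_grad f x s - grad F x))\<^sup>2 \<partial>P) \<le> \<sigma>\<^sup>2"
    and M_bound: "\<And>x w \<gamma>. x \<in> \<Omega> \<Longrightarrow> \<gamma> > 0 \<Longrightarrow> norm (prox_pt \<Omega> x w \<gamma>) \<le> M"
    and theta0: "\<theta>0 \<in> \<Omega>"
    and thetastar: "is_arg_min F (\<lambda>x. x \<in> \<Omega>) \<theta>star"
    \<comment> \<open>parameters\<close>
    and alpha: "\<And>k. k \<in> {1..N} \<Longrightarrow> \<alpha> k = 2 / (real k + 1)"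
    and beta: "\<And>k. k \<in> {1..N} \<Longrightarrow> \<beta> k = 1 / (2 * L)"
    and lam: "\<And>k. k \<in> {1..N} \<Longrightarrow> lam k = real k * \<beta> k / 2"
    and eta: "\<And>k. k \<in> {1..N} \<Longrightarrow> \<eta> k = 1 / real N"
    and chi_eq: "\<And>k. k \<in> {1..N} \<Longrightarrow> chi k = 1 / real N"
    and m: "\<And>k. k \<in> {1..N} \<Longrightarrow> m k = k"
    and Gamma: "\<And>k. k \<in> {1..N} \<Longrightarrow> \<Gamma> k = 2 / (real k * (real k + 1))"
    and p: "\<And>k. k \<in> {1..N} \<Longrightarrow> p k = inverse (\<Gamma> k) / (\<Sum>j=1..N. inverse (\<Gamma> j))"
    \<comment> \<open>samples and random iteration count\<close>
    and Q_prob: "prob_space Q"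
    and samples_indep: "prob_space.indep_vars Q (\<lambda>_. P) (\<lambda>(k, i). \<xi> k i)
                          (SIGMA k:{1..N}. {1..m k})"
    and samples_distr: "\<And>k i. k \<in> {1..N} \<Longrightarrow> i \<in> {1..m k} \<Longrightarrow> distr Q P (\<xi> k i) = P"
    and R_range: "\<And>w. w \<in> space Q \<Longrightarrow> R w \<in> {1..N}"
    and R_prob: "\<And>k. k \<in> {1..N} \<Longrightarrow> measure Q {w \<in> space Q. R w = k} = p k"
    and R_indep: "prob_space.indep_set Q {R -` A \<inter> space Q |A. A \<in> UNIV}
                    (sets (sample_history Q P \<xi> m N))"
    \<comment> \<open>the iterates; those of iteration \<open>k\<close> depend (measurably) on the samples of the first \<open>k\<close> iterations only\<close>
    and run: "\<And>w. w \<in> space Q \<Longrightarrow>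
        ncgs_run \<Omega> (stoch_grad f) \<alpha> lam \<beta> \<eta> chi m \<theta>0 N (\<lambda>k i. \<xi> k i w)
          (\<lambda>k. \<theta> k w) (\<lambda>k. \<theta>ag k w) (\<lambda>k. \<theta>md k w) (\<lambda>k. Gbar k w)"
    and adapted: "\<And>k. k \<in> {1..N} \<Longrightarrow> \<theta> k \<in> borel_measurable (sample_history Q P \<xi> m k)"
                 "\<And>k. k \<in> {1..N} \<Longrightarrow> \<theta>ag k \<in> borel_measurable (sample_history Q P \<xi> m k)"
  shows "integrable Q
           (\<lambda>w. (norm (grad_mapping \<Omega> (\<theta>md (R w) w) (Gbar (R w) w) (\<beta> (R w))))\<^sup>2) \<and>
         prob_space.expectation Q
           (\<lambda>w. (norm (grad_mapping \<Omega> (\<theta>md (R w) w) (Gbar (R w) w) (\<beta> (R w))))\<^sup>2)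
         \<le> 192 * L * (4 * L * (norm (\<theta>0 - \<theta>star))\<^sup>2 / ((real N)\<^sup>2 * (real N + 1))
              + l / real N * ((norm \<theta>star)\<^sup>2 + 2 * M\<^sup>2)
              + 1 / real N
              + 3 * \<sigma>\<^sup>2 / (2 * L * real N))"
proof -

  \<comment> \<open>Samples as one family indexed by pairs, and their histories\<close>
  interpret Q: prob_space Q by (rule Q_prob)
  interpret P: prob_space P by (rule P_prob)
  define X where "X = (\<lambda>(k, i). \<xi> k i)"
  define I where "I = (SIGMA k:{1..N}. {1..m k})"
  \<comment> \<open>\<open>J 0\<close> is empty, so \<open>H 0\<close> is the trivial sigma-algebra,
    matching the deterministic start.\<close>
  define J where "J k = (SIGMA j:{1..k}. {1..m j})" for k
  define H where "H k = generated_by Q P X (J k)" for k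
  have hist: "sample_history Q P \<xi> m k = H k" for k
    unfolding H_def J_def X_def by (rule sample_history_eq_generated_by)
  have space_H: "space (H k) = space Q" for k by (simp add: H_def)
  have indep: "Q.indep_vars (\<lambda>_. P) X I" using samples_indep by (simp add: X_def I_def)
  have distr: "distr Q P (X p) = P" if "p \<in> I" for p
    using that samples_distr by (auto simp: X_def I_def)
  have X: "X p \<in> measurable Q P" if "p \<in> I" for p
    using indep that by (auto simp: Q.indep_vars_def2)
  have J_I: "J k \<subseteq> I" if "k \<le> N" for k using that by (auto simp: J_def I_def)
  have H_mono: "Y \<in> measurable (H k) S" if "Y \<in> measurable (H j) S" "j \<le> k" for Y j k and S :: "'a measure"
    unfolding H_def by (rule measurable_generated_by_mono[OF _ that(1)[unfolded H_def]])
      (use that(2) in \<open>auto simp: J_def\<close>)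
  have H_Q: "Y \<in> measurable Q S" if "Y \<in> measurable (H k) S" "k \<le> N" for Y k and S :: "'a measure"
    by (rule measurable_from_generated_by[OF _ that(1)[unfolded H_def]]) (use X J_I[OF that(2)] in blast)

  \<comment> \<open>Feasibility and boundedness of the iterates\<close>
  have cl: "closed \<Omega>" using Omega(2) by (rule compact_imp_closed)
  have M: "norm x \<le> M" if "x \<in> \<Omega>" for x
    using M_bound[OF that, of 1 0] prox_pt_zero[OF cl Omega(3) that, of 1] by simp
  have star: "\<theta>star \<in> \<Omega>" "\<And>x. x \<in> \<Omega> \<Longrightarrow> F \<theta>star \<le> F x"
    using thetastar by (auto simp: is_arg_min_linorder)
  have \<alpha>_rng: "0 \<le> \<alpha> k \<and> \<alpha> k \<le> 1" if "k \<in> {1..N}" for k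
    using that alpha[OF that] by simp
  have pos: "lam k > 0 \<and> \<beta> k > 0 \<and> \<eta> k > 0 \<and> chi k > 0" if "k \<in> {1..N}" for k
    using that L_pos N_pos by (simp add: lam[OF that] beta[OF that] eta[OF that] chi_eq[OF that])
  have dom: "k \<le> N \<Longrightarrow> \<theta> k w \<in> \<Omega> \<and> \<theta>ag k w \<in> \<Omega>" "k \<in> {1..N} \<Longrightarrow> \<theta>md k w \<in> \<Omega>"
    if "w \<in> space Q" for k w
    by (intro ncgs_run_in_domain[OF Omega(2,3) theta0 run[OF that]] \<alpha>_rng pos; assumption)+
  note runD = ncgs_runD[OF run]

  \<comment> \<open>Measurability of the iterates with respect to the histories\<close>
  have xy_meas: "\<theta> k \<in> borel_measurable (H k)" "\<theta>ag k \<in> borel_measurable (H k)" if "k \<le> N" for k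
  proof -
    have "\<theta> k \<in> borel_measurable (H k) \<and> \<theta>ag k \<in> borel_measurable (H k)"
    proof (cases "k = 0")
      \<comment> \<open>Adaptedness is assumed from iteration 1 on; at 0 both iterates equal
        \<open>\<theta>0\<close> on every path.\<close>
      case True
      have "\<theta> 0 w = \<theta>0 \<and> \<theta>ag 0 w = \<theta>0" if "w \<in> space (H k)" for w
        using run[of w] that by (simp add: space_H ncgs_run_def)
      then have "\<theta> k \<in> borel_measurable (H k) \<longleftrightarrow> (\<lambda>_. \<theta>0) \<in> borel_measurable (H k)"
        "\<theta>ag k \<in> borel_measurable (H k) \<longleftrightarrow> (\<lambda>_. \<theta>0) \<in> borel_measurable (H k)"
        unfolding True by (intro measurable_cong; simp)+
      then show ?thesis by simp
    next
      case False
      then show ?thesis using adapted[of k] that by (simp add: hist)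
    qed
    then show "\<theta> k \<in> borel_measurable (H k)" "\<theta>ag k \<in> borel_measurable (H k)" by auto
  qed
  \<comment> \<open>The index \<open>k - 1\<close> matters: \<open>\<theta>md k\<close> is formed
    before batch \<open>k\<close> is drawn, hence is independent of it.\<close>
  have md_meas: "\<theta>md k \<in> borel_measurable (H (k - 1))" if k: "k \<in> {1..N}" for k
  proof -
    have [measurable]: "\<theta> (k - 1) \<in> borel_measurable (H (k - 1))" "\<theta>ag (k - 1) \<in> borel_measurable (H (k - 1))"
      using xy_meas[of "k - 1"] k by auto
    have "(\<lambda>w. (1 - \<alpha> k) *\<^sub>R \<theta>ag (k - 1) w + \<alpha> k *\<^sub>R \<theta> (k - 1) w) \<in> borel_measurable (H (k - 1))"
      by measurable
    then show ?thesis
      by (subst measurable_cong[OF runD(1)[OF _ k]]) (simp_all add: space_H)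
  qed

  \<comment> \<open>Moments of the gradient error\<close>
  have G_meas: "(\<lambda>(x, s). stoch_grad f x s) \<in> borel_measurable (borel \<Otimes>\<^sub>M P)"
    using f_integrable f_diff by (intro borel_measurable_stoch_grad) auto
  \<comment> \<open>\<open>grad F\<close> is a parameter integral of the jointly measurable
    stochastic gradient. This covers the whole space, whereas smoothness controls it on
    \<open>\<Omega>\<close> only.\<close>
  have grad_meas: "grad F \<in> borel_measurable borel"
    using P.borel_measurable_lebesgue_integral[OF G_meas] by (simp add: G_unbiased)
  \<comment> \<open>The state is a pair so that \<open>Z k\<close> can carry
    \<open>\<theta> (k - 1)\<close> next to \<open>\<theta>md k\<close>: the noise and the vector it
    is multiplied with are then functions of one past variable.\<close>
  define D where "D p s = stoch_grad f (fst p) s - grad F (fst p)" for p :: "'a \<times> 'a" and s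
  have D_meas: "(\<lambda>(p, s). D p s) \<in> borel_measurable ((borel \<Otimes>\<^sub>M borel) \<Otimes>\<^sub>M P)"
  proof -
    have pr: "(\<lambda>q. (fst (fst q), snd q)) \<in> measurable (((borel :: 'a measure) \<Otimes>\<^sub>M (borel :: 'a measure)) \<Otimes>\<^sub>M P) (borel \<Otimes>\<^sub>M P)"
      by measurable
    have "(\<lambda>q. grad F (fst (fst q))) \<in> borel_measurable (((borel :: 'a measure) \<Otimes>\<^sub>M (borel :: 'a measure)) \<Otimes>\<^sub>M P)"
      by (rule measurable_compose[OF _ grad_meas]) measurable
    with measurable_compose[OF pr G_meas] show ?thesis
      by (simp add: D_def case_prod_beta)
  qed
  have D_mean: "integrable P (D p) \<and> (\<integral>s. D p s \<partial>P) = 0" for p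
    unfolding D_def using G_integrable[of "fst p"] G_unbiased[of "fst p"] by (simp add: P.prob_space)
  have D_sq: "integrable P (\<lambda>s. (norm (D p s))\<^sup>2)" "(\<integral>s. (norm (D p s))\<^sup>2 \<partial>P) \<le> \<sigma>\<^sup>2" for p
    unfolding D_def by (rule G_var_integrable, rule G_variance)
  define \<delta> where "\<delta> k w = Gbar k w - grad F (\<theta>md k w)" for k w
  define Z where "Z k w = (\<theta>md k w, \<theta> (k - 1) w)" for k w
  define B where "B k = Pair k ` {1..k}" for k :: nat
  have \<delta>: "\<delta> k w = (1 / real k) *\<^sub>R (\<Sum>p\<in>B k. D (Z k w) (X p w))"
    if "k \<in> {1..N}" "w \<in> space Q" for k w
  proof -
    have "(\<Sum>p\<in>B k. D (Z k w) (X p w)) = (\<Sum>i=1..k. stoch_grad f (\<theta>md k w) (\<xi> k i w) - grad F (\<theta>md k w))"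
      by (simp add: B_def sum.reindex inj_on_def D_def Z_def X_def)
    also have "\<dots> = (\<Sum>i=1..k. stoch_grad f (\<theta>md k w) (\<xi> k i w)) - real k *\<^sub>R grad F (\<theta>md k w)"
      by (simp add: sum_subtractf sum_constant_scaleR)
    finally show ?thesis
      using runD(2)[OF that(2,1)] that by (simp add: \<delta>_def m[OF that(1)] scaleR_right_diff_distrib)
  qed
  have Z_meas: "Z k \<in> measurable (generated_by Q P X (J (k - 1))) (borel \<Otimes>\<^sub>M borel)" if k: "k \<in> {1..N}" for k
  proof -
    have "\<theta> (k - 1) \<in> borel_measurable (H (k - 1))" by (rule xy_meas) (use k in auto)
    with md_meas[OF k] show ?thesis unfolding Z_def H_def[symmetric] by (rule measurable_Pair)
  qed
  have B: "finite (B k)" "B k \<subseteq> I - J (k - 1)" "J (k - 1) \<subseteq> I" "card (B k) = k" if "k \<in> {1..N}" for k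
    using that m[OF that] by (auto simp: B_def I_def J_def card_image inj_on_def)
  have \<delta>_sq: "integrable Q (\<lambda>w. (norm (\<delta> k w))\<^sup>2)" "Q.expectation (\<lambda>w. (norm (\<delta> k w))\<^sup>2) \<le> \<sigma>\<^sup>2 / real k"
    if k: "k \<in> {1..N}" for k
  proof -
    have eq: "(norm (\<delta> k w))\<^sup>2 = 1 / (real k)\<^sup>2 * (norm (\<Sum>p\<in>B k. D (Z k w) (X p w)))\<^sup>2"
      if "w \<in> space Q" for w
      by (simp add: \<delta>[OF k that] power_divide)
    have batch: "integrable Q (\<lambda>w. (norm (\<Sum>p\<in>B k. D (Z k w) (X p w)))\<^sup>2)"
      "Q.expectation (\<lambda>w. (norm (\<Sum>p\<in>B k. D (Z k w) (X p w)))\<^sup>2) \<le> real k * \<sigma>\<^sup>2"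
      using Q.batch_noise_second_moment[OF indep distr B(3)[OF k] Z_meas[OF k] D_meas D_mean D_sq _ B(1,2)[OF k]]
      by (simp_all add: B(4)[OF k])
    then show "integrable Q (\<lambda>w. (norm (\<delta> k w))\<^sup>2)"
      by (subst Bochner_Integration.integrable_cong[OF refl eq]) auto
    have "Q.expectation (\<lambda>w. (norm (\<delta> k w))\<^sup>2)
        = 1 / (real k)\<^sup>2 * Q.expectation (\<lambda>w. (norm (\<Sum>p\<in>B k. D (Z k w) (X p w)))\<^sup>2)"
      by (subst Bochner_Integration.integral_cong[OF refl eq]) auto
    also have "\<dots> \<le> 1 / (real k)\<^sup>2 * (real k * \<sigma>\<^sup>2)"
      using batch(2) by (intro mult_left_mono) auto
    also have "\<dots> = \<sigma>\<^sup>2 / real k" by (simp add: power2_eq_square)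
    finally show "Q.expectation (\<lambda>w. (norm (\<delta> k w))\<^sup>2) \<le> \<sigma>\<^sup>2 / real k" .
  qed
  have \<delta>_inner: "integrable Q (\<lambda>w. (\<theta> (k - 1) w - \<theta>star) \<bullet> \<delta> k w)"
    "Q.expectation (\<lambda>w. (\<theta> (k - 1) w - \<theta>star) \<bullet> \<delta> k w) = 0" if k: "k \<in> {1..N}" for k
  proof -
    have eq: "(\<theta> (k - 1) w - \<theta>star) \<bullet> \<delta> k w
        = 1 / real k * ((snd (Z k w) - \<theta>star) \<bullet> (\<Sum>p\<in>B k. D (Z k w) (X p w)))"
      if "w \<in> space Q" for w
      by (simp add: \<delta>[OF k that] Z_def)
    have [measurable]: "\<theta> (k - 1) \<in> borel_measurable Q"
      using k by (intro H_Q[OF xy_meas(1)]) auto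
    have "integrable Q (\<lambda>w. (norm (snd (Z k w) - \<theta>star))\<^sup>2)"
    proof (rule Q.integrable_const_bound[where B = "(2 * M)\<^sup>2"])
      have "norm ((norm (snd (Z k w) - \<theta>star))\<^sup>2) \<le> (2 * M)\<^sup>2" if "w \<in> space Q" for w
      proof -
        have "\<theta> (k - 1) w \<in> \<Omega>" using dom(1)[OF that, of "k - 1"] k by auto
        then have "norm (\<theta> (k - 1) w - \<theta>star) \<le> 2 * M"
          using norm_triangle_ineq4[of "\<theta> (k - 1) w" \<theta>star] M[of "\<theta> (k - 1) w"] M[OF star(1)] by linarith
        from power_mono[OF this norm_ge_zero, of 2] show ?thesis by (simp add: Z_def)
      qed
      then show "AE w in Q. norm ((norm (snd (Z k w) - \<theta>star))\<^sup>2) \<le> (2 * M)\<^sup>2" by (intro AE_I2)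
    qed (unfold Z_def snd_conv, measurable)
    note batch = Q.batch_noise_inner[OF indep distr B(3)[OF k] Z_meas[OF k] D_meas D_mean D_sq _ B(2)[OF k] _ this]
    have "integrable Q (\<lambda>w. (snd (Z k w) - \<theta>star) \<bullet> (\<Sum>p\<in>B k. D (Z k w) (X p w)))"
      "Q.expectation (\<lambda>w. (snd (Z k w) - \<theta>star) \<bullet> (\<Sum>p\<in>B k. D (Z k w) (X p w))) = 0"
      by (rule batch; simp)+
    then show "integrable Q (\<lambda>w. (\<theta> (k - 1) w - \<theta>star) \<bullet> \<delta> k w)"
      "Q.expectation (\<lambda>w. (\<theta> (k - 1) w - \<theta>star) \<bullet> \<delta> k w) = 0"
      by (subst Bochner_Integration.integrable_cong[OF refl eq] Bochner_Integration.integral_cong[OF refl eq]; simp)+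
  qed

  \<comment> \<open>Expectation of the summed bound\<close>
  define a where "a k = real k * (real k + 1) / 2" for k :: nat
  define d where "d k w = (norm (\<theta>ag k w - \<theta>md k w))\<^sup>2" for k w
  have a: "a k \<ge> 0" for k by (simp add: a_def)
  have d_int: "integrable Q (d k)" if k: "k \<in> {1..N}" for k
  proof (rule Q.integrable_const_bound[where B = "(2 * M)\<^sup>2"])
    have [measurable]: "\<theta>ag k \<in> borel_measurable Q" "\<theta>md k \<in> borel_measurable Q"
      using k H_Q[OF xy_meas(2)[of k]] H_Q[OF md_meas[OF k]] by auto
    show "d k \<in> borel_measurable Q" unfolding d_def by measurable
    have "norm (d k w) \<le> (2 * M)\<^sup>2" if "w \<in> space Q" for w
    proof -
      have "norm (\<theta>ag k w - \<theta>md k w) \<le> 2 * M"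
        using norm_triangle_ineq4[of "\<theta>ag k w" "\<theta>md k w"] M[of "\<theta>ag k w"] M[of "\<theta>md k w"]
          dom[OF that, of k] k by auto
      from power_mono[OF this norm_ge_zero, of 2] show ?thesis by (simp add: d_def)
    qed
    then show "AE w in Q. norm (d k w) \<le> (2 * M)\<^sup>2" by (intro AE_I2)
  qed
  \<comment> \<open>The deterministic terms of \<open>ncgs_sum_bound\<close>.\<close>
  define C where "C = 2 * L * (norm (\<theta>0 - \<theta>star))\<^sup>2 + ((real N + 1) * (real N + 2) / 6 + (real N + 1) / 2)
      + l / 2 * (8 * M\<^sup>2 * real N + ((norm \<theta>star)\<^sup>2 + M\<^sup>2) * (real N * (real N + 1)))"
  define T where "T = (\<Sum>k=1..N. a k * Q.expectation (d k))"
  have sum_int: "integrable Q (\<lambda>w. \<Sum>k=1..N. c k * Y k w)"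
    "Q.expectation (\<lambda>w. \<Sum>k=1..N. c k * Y k w) = (\<Sum>k=1..N. c k * Q.expectation (Y k))"
    if "\<And>k. k \<in> {1..N} \<Longrightarrow> integrable Q (Y k)" for c :: "nat \<Rightarrow> real" and Y
    using that by (auto intro!: Bochner_Integration.integrable_sum simp: Bochner_Integration.integral_sum)
  have d_sum: "integrable Q (\<lambda>w. \<Sum>k=1..N. a k * d k w)"
    "Q.expectation (\<lambda>w. \<Sum>k=1..N. a k * d k w) = T"
    unfolding T_def by (rule sum_int, erule d_int)+
  have \<delta>_sum: "integrable Q (\<lambda>w. \<Sum>k=1..N. a k * (norm (\<delta> k w))\<^sup>2)"
    "Q.expectation (\<lambda>w. \<Sum>k=1..N. a k * (norm (\<delta> k w))\<^sup>2)
      = (\<Sum>k=1..N. a k * Q.expectation (\<lambda>w. (norm (\<delta> k w))\<^sup>2))"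
    by (rule sum_int, erule \<delta>_sq(1))+
  have inner_sum: "integrable Q (\<lambda>w. \<Sum>k=1..N. real k * ((\<theta> (k - 1) w - \<theta>star) \<bullet> \<delta> k w))"
    "Q.expectation (\<lambda>w. \<Sum>k=1..N. real k * ((\<theta> (k - 1) w - \<theta>star) \<bullet> \<delta> k w))
      = (\<Sum>k=1..N. real k * Q.expectation (\<lambda>w. (\<theta> (k - 1) w - \<theta>star) \<bullet> \<delta> k w))"
    by (rule sum_int, erule \<delta>_inner(1))+
  have "L / 4 * T = Q.expectation (\<lambda>w. L / 4 * (\<Sum>k=1..N. a k * d k w))"
    by (simp only: d_sum integral_mult_right_zero)
  also have "\<dots> \<le> Q.expectation (\<lambda>w. C + (\<Sum>k=1..N. a k * (norm (\<delta> k w))\<^sup>2) / L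
      - (\<Sum>k=1..N. real k * ((\<theta> (k - 1) w - \<theta>star) \<bullet> \<delta> k w)))"
  proof (rule integral_mono)
    fix w assume w: "w \<in> space Q"
    show "L / 4 * (\<Sum>k=1..N. a k * d k w) \<le> C + (\<Sum>k=1..N. a k * (norm (\<delta> k w))\<^sup>2) / L
      - (\<Sum>k=1..N. real k * ((\<theta> (k - 1) w - \<theta>star) \<bullet> \<delta> k w))"
      unfolding a_def d_def \<delta>_def C_def
      by (rule ncgs_sum_bound[OF Omega(2,3) theta0 L_pos l_nonneg N_pos F_diff F_smooth F_lower M star
            alpha beta lam eta chi_eq run[OF w]])
  qed (intro Bochner_Integration.integrable_diff Bochner_Integration.integrable_add
      Bochner_Integration.integrable_divide integrable_mult_right Q.integrable_const
      d_sum(1) \<delta>_sum(1) inner_sum(1))+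
  also have "\<dots> = C + (\<Sum>k=1..N. a k * Q.expectation (\<lambda>w. (norm (\<delta> k w))\<^sup>2)) / L"
  proof -
    have "(\<Sum>k=1..N. real k * Q.expectation (\<lambda>w. (\<theta> (k - 1) w - \<theta>star) \<bullet> \<delta> k w)) = 0"
      using \<delta>_inner(2) by (intro sum.neutral) auto
    then have "Q.expectation (\<lambda>w. \<Sum>k=1..N. real k * ((\<theta> (k - 1) w - \<theta>star) \<bullet> \<delta> k w)) = 0"
      by (simp only: inner_sum(2))
    then show ?thesis
      using \<delta>_sum inner_sum(1) by (simp add: Q.prob_space)
  qed
  also have "\<dots> \<le> C + \<sigma>\<^sup>2 * (real N * (real N + 3) / 4) / L"
  proof -
    \<comment> \<open>Batch size \<open>k\<close> reduces the quadratic weight \<open>a k\<close> to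
      a linear one, so the noise sum is of order \<open>N\<close> squared against a total weight of
      order \<open>N\<close> cubed.\<close>
    have "(\<Sum>k=1..N. a k * Q.expectation (\<lambda>w. (norm (\<delta> k w))\<^sup>2)) \<le> (\<Sum>k=1..N. \<sigma>\<^sup>2 * ((real k + 1) / 2))"
    proof (rule sum_mono)
      fix k assume k: "k \<in> {1..N}"
      have "a k * Q.expectation (\<lambda>w. (norm (\<delta> k w))\<^sup>2) \<le> a k * (\<sigma>\<^sup>2 / real k)"
        by (rule mult_left_mono[OF \<delta>_sq(2)[OF k] a])
      also have "\<dots> = \<sigma>\<^sup>2 * ((real k + 1) / 2)" using k by (simp add: a_def)
      finally show "a k * Q.expectation (\<lambda>w. (norm (\<delta> k w))\<^sup>2) \<le> \<sigma>\<^sup>2 * ((real k + 1) / 2)" .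
    qed
    also have "\<dots> = \<sigma>\<^sup>2 * (real N * (real N + 3) / 4)"
      by (simp only: sum_distrib_left[symmetric] sum_succ_half_real)
    finally show ?thesis
      by (intro add_left_mono divide_right_mono) (simp_all add: less_imp_le[OF L_pos])
  qed
  finally have T: "L / 4 * T \<le> C + \<sigma>\<^sup>2 * (real N * (real N + 3) / 4) / L" .

  \<comment> \<open>The gradient mapping at the random iteration\<close>
  define h where "h k w = (norm (grad_mapping \<Omega> (\<theta>md k w) (Gbar k w) (\<beta> k)))\<^sup>2" for k w
  have h_le: "h k w \<le> 8 * L\<^sup>2 * d k w + 4 * L / real N" if k: "k \<in> {1..N}" and w: "w \<in> space Q" for k w
  proof -
    have "h k w \<le> 2 / (\<beta> k)\<^sup>2 * d k w + 2 * chi k / \<beta> k"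
      unfolding h_def d_def using pos[OF k] dom(2)[OF w k]
      by (intro grad_mapping_condg_bound[OF Omega(2,3) _ _ _ runD(4)[OF w k]]) auto
    then show ?thesis using L_pos by (simp add: beta[OF k] chi_eq[OF k] power_divide power_mult_distrib)
  qed
  \<comment> \<open>Measurability is needed in the history \<open>H N\<close> and not merely in
    \<open>Q\<close>, since it is this history that \<open>R\<close> is independent of.\<close>
  have h_meas: "h k \<in> borel_measurable (H N)" if k: "k \<in> {1..N}" for k
  proof -
    have md: "\<theta>md k \<in> borel_measurable (H N)"
      using k by (intro H_mono[OF md_meas[OF k]]) auto
    have "Gbar k \<in> borel_measurable (H N)"
    proof (subst measurable_cong[OF runD(2)[OF _ k]])
      show "(\<lambda>w. (1 / real (m k)) *\<^sub>R (\<Sum>i=1..m k. stoch_grad f (\<theta>md k w) (\<xi> k i w))) \<in> borel_measurable (H N)"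
      proof (intro borel_measurable_scaleR borel_measurable_sum measurable_const)
        fix i assume "i \<in> {1..m k}"
        then have "(k, i) \<in> J N" "(k, i) \<in> I" using k by (auto simp: J_def I_def)
        then have "X (k, i) \<in> measurable (H N) P"
          unfolding H_def using X by (intro measurable_generated_by_member)
        from measurable_compose[OF measurable_Pair[OF md this] G_meas]
        show "(\<lambda>w. stoch_grad f (\<theta>md k w) (\<xi> k i w)) \<in> borel_measurable (H N)" by (simp add: X_def)
      qed simp
    qed (simp_all add: space_H)
    with md have "(\<lambda>w. grad_mapping \<Omega> (\<theta>md k w) (Gbar k w) (\<beta> k)) \<in> borel_measurable (H N)"
      using pos[OF k] by (intro borel_measurable_grad_mapping cl Omega) auto
    then show ?thesis unfolding h_def by measurable
  qed
  have h_int: "integrable Q (h k)" if k: "k \<in> {1..N}" for k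
  proof (rule Bochner_Integration.integrable_bound)
    show "integrable Q (\<lambda>w. 8 * L\<^sup>2 * d k w + 4 * L / real N)" using d_int[OF k] by simp
    show "h k \<in> borel_measurable Q"
      by (rule measurable_from_generated_by[OF _ h_meas[OF k, unfolded H_def]]) (use X J_I[of N] in blast)
    have "norm (h k w) \<le> norm (8 * L\<^sup>2 * d k w + 4 * L / real N)" if "w \<in> space Q" for w
    proof -
      have "0 \<le> h k w" by (simp add: h_def)
      then show ?thesis using h_le[OF k that] by (simp only: real_norm_def abs_of_nonneg)
    qed
    then show "AE w in Q. norm (h k w) \<le> norm (8 * L\<^sup>2 * d k w + 4 * L / real N)"
      by (intro AE_I2)
  qed
  have R: "integrable Q (\<lambda>w. h (R w) w)"
    "Q.expectation (\<lambda>w. h (R w) w) = (\<Sum>k\<in>{1..N}. Q.prob {w \<in> space Q. R w = k} * Q.expectation (h k))"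
    by (rule Q.expectation_random_index[OF R_indep[unfolded hist] space_H];
        (erule R_range h_meas h_int | rule finite_atLeastAtMost))+
  define s where "s = real N * (real N + 1) * (real N + 2) / 6"
  have s: "s > 0" using N_pos by (simp add: s_def)
  have sum_a: "(\<Sum>k=1..N. a k) = s" unfolding a_def s_def by (rule sum_triangular_real)
  \<comment> \<open>The law of \<open>R\<close> uses the very weights of the summed bound, so the
    expectation over \<open>R\<close> turns into \<open>T / s\<close>.\<close>
  have prob: "Q.prob {w \<in> space Q. R w = k} = a k / s" if k: "k \<in> {1..N}" for k
  proof -
    have "inverse (\<Gamma> j) = a j" if "j \<in> {1..N}" for j using Gamma[OF that] by (simp add: a_def)
    then have "p k = a k / (\<Sum>j=1..N. a j)" using p[OF k] k by simp
    then show ?thesis using R_prob[OF k] by (simp only: sum_a)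
  qed
  have "Q.expectation (\<lambda>w. h (R w) w) \<le> (\<Sum>k=1..N. a k / s * (8 * L\<^sup>2 * Q.expectation (d k) + 4 * L / real N))"
    unfolding R(2)
  proof (rule sum_mono)
    fix k assume k: "k \<in> {1..N}"
    have "Q.expectation (h k) \<le> Q.expectation (\<lambda>w. 8 * L\<^sup>2 * d k w + 4 * L / real N)"
      using h_int[OF k] d_int[OF k] h_le[OF k] by (intro integral_mono) auto
    also have "\<dots> = 8 * L\<^sup>2 * Q.expectation (d k) + 4 * L / real N"
      using d_int[OF k] by (simp add: Q.prob_space)
    finally show "Q.prob {w \<in> space Q. R w = k} * Q.expectation (h k)
        \<le> a k / s * (8 * L\<^sup>2 * Q.expectation (d k) + 4 * L / real N)"
      unfolding prob[OF k] using s a by (intro mult_left_mono) auto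
  qed
  also have "\<dots> = 8 * L\<^sup>2 * (T / s) + 4 * L / real N"
  proof -
    have "(\<Sum>k=1..N. a k / s * (8 * L\<^sup>2 * Q.expectation (d k) + 4 * L / real N))
        = (\<Sum>k=1..N. 8 * L\<^sup>2 / s * (a k * Q.expectation (d k)) + 4 * L / real N / s * a k)"
      by (intro sum.cong refl) (simp add: distrib_left mult_ac)
    also have "\<dots> = 8 * L\<^sup>2 / s * T + 4 * L / real N / s * s"
      unfolding sum.distrib sum_distrib_left[symmetric] T_def sum_a ..
    finally show ?thesis using s by simp
  qed
  also have "\<dots> \<le> 192 * L * (4 * L * (norm (\<theta>0 - \<theta>star))\<^sup>2 / ((real N)\<^sup>2 * (real N + 1))
      + l / real N * ((norm \<theta>star)\<^sup>2 + 2 * M\<^sup>2) + 1 / real N + 3 * \<sigma>\<^sup>2 / (2 * L * real N))"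
    unfolding s_def
    by (rule ncgs_rate) (use N_pos L_pos l_nonneg T in \<open>simp_all add: C_def\<close>)
  finally show ?thesis using R(1) unfolding h_def by blast
qed

end
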